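(* Let $q_{\mathrm{ch}}^\star\in\mathbb{R}^{n_{\mathrm{ch}}}$ and $V_{\mathrm{sh}}^\star\in\mathbb{R}^{n_{\mathrm{pr}}}$ be arbitrary constant pre-specified setpoints, let $M_{\mathrm{ch}},N_{\mathrm{ch}}\in\mathbb{R}^{n_{\mathrm{ch}}\times n_{\mathrm{ch}}}$ and $N_{\mathrm{pr}},N_{\mathrm{sh}},M_{\mathrm{a}},M_{\mathrm{b}}\in\mathbb{R}^{n_{\mathrm{pr}}\times n_{\mathrm{pr}}}$ be constant, positive definite diagonal matrices, and consider the district heating flow and volume dynamics $$J_{\mathrm{ch}}\dot q_{\mathrm{ch}}=f_{\mathrm{ch}}(q_{\mathrm{ch}})+u_{\mathrm{ch}},\qquad J_{\mathrm{pr}}\dot q_{\mathrm{pr}}=-W(q_{\mathrm{pr}})\theta+u_{\mathrm{pr}},\qquad \dot V_{\mathrm{sh}}=q_{\mathrm{pr}}-Bq_{\mathrm{ch}}$$ in closed loop with the dynamic controllers $$\dot x_{\mathrm{ch}}=-M_{\mathrm{ch}}(q_{\mathrm{ch}}-q_{\mathrm{ch}}^\star),\qquad u_{\mathrm{ch}}=-N_{\mathrm{ch}}(q_{\mathrm{ch}}-q_{\mathrm{ch}}^\star)+x_{\mathrm{ch}},$$ and $$\begin{aligned}\dot x_{\mathrm{a}}&=-M_{\mathrm{a}}(V_{\mathrm{sh}}-V_{\mathrm{sh}}^\star),\\ \dot x_{\mathrm{b}}&=-M_{\mathrm{b}}W(q_{\mathrm{pr}})z_{\mathrm{pr}},\\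 u_{\mathrm{pr}}&=W(q_{\mathrm{pr}})x_{\mathrm{b}}-\bigl(J_{\mathrm{pr}}(M_{\mathrm{a}}-N_{\mathrm{sh}}^2)+I\bigr)(V_{\mathrm{sh}}-V_{\mathrm{sh}}^\star)-(J_{\mathrm{pr}}N_{\mathrm{sh}}+N_{\mathrm{pr}})z_{\mathrm{pr}}+J_{\mathrm{pr}}N_{\mathrm{sh}}(Bq_{\mathrm{ch}}-x_{\mathrm{a}}),\end{aligned}$$ where $z_{\mathrm{pr}}:=q_{\mathrm{pr}}-x_{\mathrm{a}}+N_{\mathrm{sh}}(V_{\mathrm{sh}}-V_{\mathrm{sh}}^\star)$. The overall closed-loop system has state $(q_{\mathrm{ch}},x_{\mathrm{ch}},q_{\mathrm{pr}},V_{\mathrm{sh}},x_{\mathrm{a}},x_{\mathrm{b}})\in\mathbb{R}^{n_{\mathrm{ch}}}\times\mathbb{R}^{n_{\mathrm{ch}}}\times(\mathbb{R}^{n_{\mathrm{pr}}})^4$. Suppose that the steady-state value $\bar q_{\mathrm{pr}}$ of $q_{\mathrm{pr}}$ satisfies $\bar q_{\mathrm{pr},i}\neq 0$ for all $i=1,\dots,n_{\mathrm{pr}}$ (that is, the closed-loop system admits an equilibrium whose $q_{\mathrm{pr}}$-component has all entries nonzero). Then the overall closed-loop system has a (locally) asymptotically stable equilibrium, and $$\lim_{t\to\infty}q_{\mathrm{ch}}(t)=q_{\mathrm{ch}}^\star,\qquad \lim_{t\to\infty}V_{\mathrm{sh}}(t)=V_{\mathrm{sh}}^\star$$ for all solutions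 whose initial conditions are sufficiently close to that equilibrium.
   Context: Model of a district heating system with $n_{\mathrm{pr}}$ producers, each interfaced to the network through a storage tank. Here $q_{\mathrm{ch}}(t)\in\mathbb{R}^{n_{\mathrm{ch}}}$ is a vector of independent network flows, $q_{\mathrm{pr}}(t)\in\mathbb{R}^{n_{\mathrm{pr}}}$ the vector of producer flows, $V_{\mathrm{sh}}(t)\in\mathbb{R}^{n_{\mathrm{pr}}}$ the vector of hot-water volumes in the storage tanks, and $u_{\mathrm{ch}}\in\mathbb{R}^{n_{\mathrm{ch}}}$, $u_{\mathrm{pr}}\in\mathbb{R}^{n_{\mathrm{pr}}}$ are the control inputs. Standing assumptions: - $J_{\mathrm{ch}}\in\mathbb{R}^{n_{\mathrm{ch}}\times n_{\mathrm{ch}}}$ is constant, symmetric and positive definite; $J_{\mathrm{pr}}\in\mathbb{R}^{n_{\mathrm{pr}}\times n_{\mathrm{pr}}}$ is constant, diagonal and positive definite. - $f_{\mathrm{ch}}:\mathbb{R}^{n_{\mathrm{ch}}}\to\mathbb{R}^{n_{\mathrm{ch}}}$ is continuously differentiable and $-f_{\mathrm{ch}}$ is monotone, i.e. $(x-y)^\top(f_{\mathrm{ch}}(x)-f_{\mathrm{ch}}(y))\le 0$ for all $x,y\in\mathbb{R}^{n_{\mathrm{ch}}}$. - $\theta=(\theta_1,\dots,\theta_{n_{\mathrm{pr}}})^\top$ is a constant vector with $\theta_i>0$ (unknown to the controllers). - $W(q_{\mathrm{pr}})$ is the $n_{\mathrm{pr}}\times n_{\mathrm{pr}}$ diagonal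 matrix with $i$-th diagonal entry $|q_{\mathrm{pr},i}|\,q_{\mathrm{pr},i}$. - $B\in\mathbb{R}^{n_{\mathrm{pr}}\times n_{\mathrm{ch}}}$ is a constant matrix with entries in $\{-1,0,1\}$. A bar over a signal denotes its steady-state (equilibrium) value. $I$ is the identity matrix. No constraints are imposed on the state variables or inputs. *)

theory Defs
  imports "HOL-Analysis.Analysis"
begin

section \<open>Matrices and vector fields\<close>

definition diagonal_matrix :: "real ^ 'n ^ 'n \<Rightarrow> bool" where
  "diagonal_matrix A \<longleftrightarrow> (\<forall>i j. i \<noteq> j \<longrightarrow> A $ i $ j = 0)"

definition symmetric_matrix :: "real ^ 'n ^ 'n \<Rightarrow> bool" where
  "symmetric_matrix A \<longleftrightarrow> transpose A = A"

text \<open>Symmetry is not part of this definition; it is required separately.\<close>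

definition positive_definite :: "real ^ 'n ^ 'n \<Rightarrow> bool" where
  "positive_definite A \<longleftrightarrow> (\<forall>x. x \<noteq> 0 \<longrightarrow> 0 < x \<bullet> (A *v x))"

definition continuously_differentiable :: "(real ^ 'n \<Rightarrow> real ^ 'm) \<Rightarrow> bool" where
  "continuously_differentiable f \<longleftrightarrow>
     (\<exists>Df :: real ^ 'n \<Rightarrow> real ^ 'n ^ 'm.
        (\<forall>x. (f has_derivative (\<lambda>h. Df x *v h)) (at x)) \<and> continuous_on UNIV Df)"

definition monotone_operator :: "(real ^ 'n \<Rightarrow> real ^ 'n) \<Rightarrow> bool" where
  "monotone_operator g \<longleftrightarrow> (\<forall>x y. 0 \<le> (x - y) \<bullet> (g x - g y))"

section \<open>Autonomous systems\<close>

text \<open>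
  An autonomous system is given in implicit form, as a relation \<open>S x v\<close> between a state \<open>x\<close>
  and its velocity \<open>v\<close>. This allows equations such as \<open>J q' = f q + u\<close> to be written without
  inverting \<open>J\<close>. A trajectory is a solution on \<open>[0, \<infinity>)\<close>; the derivative at time 0 is one-sided.
\<close>

definition trajectory ::
  "('a::real_normed_vector \<Rightarrow> 'a \<Rightarrow> bool) \<Rightarrow> (real \<Rightarrow> 'a) \<Rightarrow> bool" where
  "trajectory S x \<longleftrightarrow>
     (\<forall>t\<ge>0. \<exists>v. (x has_vector_derivative v) (at t within {0..}) \<and> S (x t) v)"

definition equilibrium :: "('a::real_normed_vector \<Rightarrow> 'a \<Rightarrow> bool) \<Rightarrow> 'a \<Rightarrow> bool" where
  "equilibrium S e \<longleftrightarrow> S e 0"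

text \<open>
  Stability includes the global existence, forward in time, of solutions starting close to the
  equilibrium, so that statements about all nearby trajectories are not vacuous.
\<close>

definition stable_equilibrium :: "('a::real_normed_vector \<Rightarrow> 'a \<Rightarrow> bool) \<Rightarrow> 'a \<Rightarrow> bool" where
  "stable_equilibrium S e \<longleftrightarrow> equilibrium S e \<and>
     (\<forall>\<epsilon>>0. \<exists>\<delta>>0. \<forall>x0. dist x0 e < \<delta> \<longrightarrow>
        (\<exists>x. trajectory S x \<and> x 0 = x0) \<and>
        (\<forall>x. trajectory S x \<and> x 0 = x0 \<longrightarrow> (\<forall>t\<ge>0. dist (x t) e < \<epsilon>)))"

definition locally_attractive :: "('a::real_normed_vector \<Rightarrow> 'a \<Rightarrow> bool) \<Rightarrow> 'a \<Rightarrow> bool" where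
  "locally_attractive S e \<longleftrightarrow>
     (\<exists>\<delta>>0. \<forall>x. trajectory S x \<and> dist (x 0) e < \<delta> \<longrightarrow> (x \<longlongrightarrow> e) at_top)"

definition asymptotically_stable :: "('a::real_normed_vector \<Rightarrow> 'a \<Rightarrow> bool) \<Rightarrow> 'a \<Rightarrow> bool" where
  "asymptotically_stable S e \<longleftrightarrow> stable_equilibrium S e \<and> locally_attractive S e"

section \<open>District heating system with flow and volume controllers\<close>

definition W :: "real ^ 'pr \<Rightarrow> real ^ 'pr ^ 'pr" where
  "W q = (\<chi> i j. if i = j then \<bar>q $ i\<bar> * q $ i else 0)"

definition z_pr ::
  "real ^ 'pr ^ 'pr \<Rightarrow> real ^ 'pr \<Rightarrow> real ^ 'pr \<Rightarrow> real ^ 'pr \<Rightarrow> real ^ 'pr \<Rightarrow> real ^ 'pr" where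
  "z_pr Nsh Vref qpr Vsh xa = qpr - xa + Nsh *v (Vsh - Vref)"

definition u_ch ::
  "real ^ 'ch ^ 'ch \<Rightarrow> real ^ 'ch \<Rightarrow> real ^ 'ch \<Rightarrow> real ^ 'ch \<Rightarrow> real ^ 'ch" where
  "u_ch Nch qref qch xch = - (Nch *v (qch - qref)) + xch"

definition u_pr ::
  "real ^ 'pr ^ 'pr \<Rightarrow> real ^ 'ch ^ 'pr \<Rightarrow> real ^ 'pr ^ 'pr \<Rightarrow> real ^ 'pr ^ 'pr \<Rightarrow> real ^ 'pr ^ 'pr \<Rightarrow>
   real ^ 'pr \<Rightarrow> real ^ 'ch \<Rightarrow> real ^ 'pr \<Rightarrow> real ^ 'pr \<Rightarrow> real ^ 'pr \<Rightarrow> real ^ 'pr \<Rightarrow> real ^ 'pr" where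
  "u_pr Jpr B Npr Nsh Ma Vref qch qpr Vsh xa xb =
     W qpr *v xb
     - (Jpr ** (Ma - Nsh ** Nsh) + mat 1) *v (Vsh - Vref)
     - (Jpr ** Nsh + Npr) *v z_pr Nsh Vref qpr Vsh xa
     + (Jpr ** Nsh) *v (B *v qch - xa)"

text \<open>
  The state is \<open>(qch, xch, qpr, Vsh, xa, xb)\<close>; the primed variables are the time derivatives of
  the unprimed ones.
\<close>

type_synonym ('ch, 'pr) dh_state =
  "(real ^ 'ch) \<times> (real ^ 'ch) \<times> (real ^ 'pr) \<times> (real ^ 'pr) \<times> (real ^ 'pr) \<times> (real ^ 'pr)"

fun closed_loop ::
  "real ^ 'ch ^ 'ch \<Rightarrow> real ^ 'pr ^ 'pr \<Rightarrow> (real ^ 'ch \<Rightarrow> real ^ 'ch) \<Rightarrow> real ^ 'pr \<Rightarrow> real ^ 'ch ^ 'pr \<Rightarrow>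
   real ^ 'ch ^ 'ch \<Rightarrow> real ^ 'ch ^ 'ch \<Rightarrow>
   real ^ 'pr ^ 'pr \<Rightarrow> real ^ 'pr ^ 'pr \<Rightarrow> real ^ 'pr ^ 'pr \<Rightarrow> real ^ 'pr ^ 'pr \<Rightarrow>
   real ^ 'ch \<Rightarrow> real ^ 'pr \<Rightarrow> ('ch, 'pr) dh_state \<Rightarrow> ('ch, 'pr) dh_state \<Rightarrow> bool" where
  "closed_loop Jch Jpr fch \<theta> B Mch Nch Npr Nsh Ma Mb qref Vref
     (qch, xch, qpr, Vsh, xa, xb) (qch', xch', qpr', Vsh', xa', xb') \<longleftrightarrow>
     Jch *v qch' = fch qch + u_ch Nch qref qch xch \<and>
     Jpr *v qpr' = - (W qpr *v \<theta>) + u_pr Jpr B Npr Nsh Ma Vref qch qpr Vsh xa xb \<and>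
     Vsh' = qpr - B *v qch \<and>
     xch' = - (Mch *v (qch - qref)) \<and>
     xa' = - (Ma *v (Vsh - Vref)) \<and>
     xb' = - (Mb *v (W qpr *v z_pr Nsh Vref qpr Vsh xa))"

end

theory Submission
  imports Defs
begin

text \<open>
  At an equilibrium with nonzero producer flows, \<open>qch = qref\<close>, \<open>Vsh = Vref\<close>, \<open>qpr = xa = B qref\<close> and
  \<open>xb = \<theta>\<close>. Let \<open>p\<close>, \<open>s\<close>, \<open>v\<close>, \<open>a\<close>, \<open>b\<close> be the deviations of \<open>qch\<close>, \<open>xch\<close>, \<open>Vsh\<close>, \<open>xa\<close>, \<open>xb\<close> from it,
  \<open>W\<close> and \<open>W0\<close> the matrix \<open>W qpr\<close> at the current state and at the equilibrium. With \<open>z = z_pr\<close>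
  replacing \<open>qpr\<close>, the producer side reads
  \<open>Jpr z' = W b - v - Npr z\<close>, \<open>v' = z + a - Nsh v - B p\<close>, \<open>a' = - Ma v\<close>, \<open>b' = - Mb W z\<close>, so a weighted
  sum of squares is a Lyapunov function whose derivative is negative definite in \<open>(p, z, v)\<close> only.
  Instead of invoking LaSalle's principle, small cross terms
  \<open>- \<epsilon> (s \<bullet> Jch p + a \<bullet> v + z \<bullet> Jpr W0 b)\<close> are added. They produce the missing \<open>- |s|\<^sup>2 - |a|\<^sup>2 - |b|\<^sup>2\<close>,
  the last one because \<open>W W0\<close> is positive definite near the equilibrium, where all flows are nonzero.
  The resulting quadratic form is a strict Lyapunov function, which gives exponential convergence.
  Solutions are obtained by applying Picard iteration to the field composed with the projection to
  a ball, which they never leave.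
\<close>

section \<open>Global solutions of Lipschitz differential equations\<close>

lemma has_integral_exp_mult:
  assumes "(k::real) > 0" "0 \<le> t"
  shows "((\<lambda>s. exp (k * s)) has_integral (exp (k * t) - 1) / k) {0..t}"
proof -
  have "((\<lambda>s. exp (k * s)) has_integral (exp (k * t) / k - exp (k * 0) / k)) {0..t}"
    using assms
    by (intro fundamental_theorem_of_calculus)
      (auto intro!: derivative_eq_intros simp: has_real_derivative_iff_has_vector_derivative[symmetric])
  then show ?thesis by (simp add: diff_divide_distrib)
qed

lemma has_vector_derivative_integral_atLeast:
  fixes f :: "real \<Rightarrow> 'a::banach"
  assumes f: "continuous_on UNIV f" and t: "0 \<le> t"
  shows "((\<lambda>u. integral {0..u} f) has_vector_derivative f t) (at t within {0..})"
proof -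
  \<comment> \<open>The right end \<open>t+1\<close> keeps \<open>t\<close> off the upper boundary,
    so the derivative within the interval is the one within the half line, one-sided at 0.\<close>
  have "((\<lambda>u. integral {0..u} f) has_vector_derivative f t) (at t within {0..t+1})"
    using t by (intro integral_has_vector_derivative continuous_on_subset[OF f]) auto
  moreover have "at t within {0..t+1} = at t within {0..}"
    by (rule at_within_nhd[of _ "{..<t+1}"]) auto
  ultimately show ?thesis by simp
qed

text \<open>
  The weight \<open>exp (- (2 * L + 1) * t)\<close> makes the Picard operator a contraction on the whole
  half line, so that no patching of local solutions is needed.
\<close>

lemma lipschitz_bounded_ode_solution:
  fixes g :: "'a::banach \<Rightarrow> 'a"
  assumes lip: "L-lipschitz_on UNIV g" and bdd: "bounded (range g)"
  shows "\<exists>x. x 0 = x0 \<and> (\<forall>t\<ge>0. (x has_vector_derivative g (x t)) (at t within {0..}))"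
proof -
  \<comment> \<open>This makes \<open>L / k\<close> at most 1/2, the contraction factor below, and
    keeps \<open>k\<close> positive even for \<open>L = 0\<close>.\<close>
  define k where "k = 2 * L + 1"
  have L: "0 \<le> L" using lip by (rule lipschitz_on_nonneg)
  have k: "k > 0" "L \<le> k / 2" using L by (auto simp: k_def)
  obtain M where M: "\<And>x. norm (g x) \<le> M" using bdd by (auto simp: bounded_iff)
  have M0: "0 \<le> M" using M[of 0] norm_ge_zero order_trans by blast
  \<comment> \<open>The unknown \<open>y\<close> is the solution scaled by
    \<open>exp (- k * t)\<close>. Scaling the function instead of the metric lets the ordinary sup
    distance on bounded continuous functions serve.\<close>
  define \<psi> where "\<psi> y s = g (exp (k * s) *\<^sub>R apply_bcontfun y s)" for y :: "real \<Rightarrow>\<^sub>C 'a" and s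
  define X where "X y t = x0 + integral {0..t} (\<psi> y)" for y t
  \<comment> \<open>Bounded continuous functions live on the whole line, so \<open>max 0 t\<close>
    continues the operator to negative times by its value at 0.\<close>
  define T where "T y t = exp (- k * max 0 t) *\<^sub>R X y (max 0 t)" for y t
  have cg: "continuous_on UNIV g" by (rule lipschitz_on_continuous_on[OF lip])
  have c\<psi>: "continuous_on UNIV (\<psi> y)" for y
    unfolding \<psi>_def by (intro continuous_on_compose2[OF cg] continuous_intros) auto
  have i\<psi>: "\<psi> y integrable_on {0..t}" for y t
    by (rule integrable_continuous_real) (rule continuous_on_subset[OF c\<psi>], simp)
  have dX: "(X y has_vector_derivative \<psi> y t) (at t within {0..})" if "0 \<le> t" for y t
    unfolding X_def using has_vector_derivative_integral_atLeast[OF c\<psi> that]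
    by (auto intro!: derivative_eq_intros)
  have cX: "continuous_on {0..} (X y)" for y
    by (rule continuous_on_vector_derivative[where f' = "\<psi> y"]) (use dX in auto)
  have T_cont: "continuous_on UNIV (T y)" for y
    unfolding T_def by (intro continuous_intros continuous_on_compose2[OF cX]) auto
  \<comment> \<open>As \<open>g\<close> is bounded by \<open>M\<close>, the integral is at most
    \<open>M / k * exp (k * t)\<close>, and the scaling makes this a constant. Hence
    \<open>T\<close> maps into the bounded functions.\<close>
  have T_bound: "norm (T y t) \<le> norm x0 + M / k" for y t
  proof -
    define u where "u = max 0 t"
    have u: "0 \<le> u" by (simp add: u_def)
    have "norm (integral {0..u} (\<psi> y)) \<le> integral {0..u} (\<lambda>s. M * exp (k * s))"
    proof (rule integral_norm_bound_integral[OF i\<psi>])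
      show "(\<lambda>s. M * exp (k * s)) integrable_on {0..u}"
        by (intro integrable_continuous_real continuous_intros)
      fix s assume "s \<in> {0..u}"
      then have "M * 1 \<le> M * exp (k * s)" using M0 k by (intro mult_left_mono) auto
      then show "norm (\<psi> y s) \<le> M * exp (k * s)" using M unfolding \<psi>_def by (smt (verit))
    qed
    also have "\<dots> = M * ((exp (k * u) - 1) / k)"
      by (intro integral_unique has_integral_mult_right has_integral_exp_mult k u)
    also have "\<dots> \<le> M / k * exp (k * u)" using M0 k by (simp add: field_simps)
    finally have "norm (X y u) \<le> norm x0 + M / k * exp (k * u)"
      unfolding X_def by (smt (verit) norm_triangle_ineq)
    also have "norm x0 \<le> norm x0 * exp (k * u)" using k u by (simp add: mult_le_cancel_left1)
    finally have "norm (X y u) \<le> (norm x0 + M / k) * exp (k * u)" by (simp add: algebra_simps)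
    then show ?thesis by (simp add: T_def u_def[symmetric] exp_minus divide_simps)
  qed
  have T_bc: "T y \<in> bcontfun" for y
    using T_cont T_bound by (intro bcontfun_normI)
  define \<Phi> where "\<Phi> y = Bcontfun (T y)" for y
  have \<Phi>: "apply_bcontfun (\<Phi> y) = T y" for y
    by (simp add: \<Phi>_def Bcontfun_inverse T_bc)
  have "dist (\<Phi> y) (\<Phi> y') \<le> 1/2 * dist y y'" for y y'
  proof (rule dist_bound)
    fix t :: real
    define u where "u = max 0 t"
    have u: "0 \<le> u" by (simp add: u_def)
    have "norm (integral {0..u} (\<lambda>s. \<psi> y s - \<psi> y' s)) \<le> integral {0..u} (\<lambda>s. L * dist y y' * exp (k * s))"
    proof (rule integral_norm_bound_integral)
      show "(\<lambda>s. L * dist y y' * exp (k * s)) integrable_on {0..u}"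
        by (intro integrable_continuous_real continuous_intros)
      show "(\<lambda>s. \<psi> y s - \<psi> y' s) integrable_on {0..u}" by (intro integrable_diff i\<psi>)
      fix s
      have "norm (\<psi> y s - \<psi> y' s) \<le> L * norm (exp (k * s) *\<^sub>R y s - exp (k * s) *\<^sub>R y' s)"
        unfolding \<psi>_def by (rule lipschitz_on_normD[OF lip]) auto
      also have "\<dots> = L * (exp (k * s) * dist (y s) (y' s))"
        by (simp add: scaleR_diff_right[symmetric] dist_norm)
      also have "\<dots> \<le> L * (exp (k * s) * dist y y')"
        using L by (intro mult_left_mono dist_bounded) auto
      finally show "norm (\<psi> y s - \<psi> y' s) \<le> L * dist y y' * exp (k * s)" by (simp add: mult_ac)
    qed
    also have "\<dots> = L * dist y y' * ((exp (k * u) - 1) / k)"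
      by (intro integral_unique has_integral_mult_right has_integral_exp_mult k u)
    also have "\<dots> \<le> (k / 2) * dist y y' * (exp (k * u) / k)"
      using L k u by (intro mult_mono divide_right_mono) auto
    finally have "norm (X y u - X y' u) \<le> 1/2 * dist y y' * exp (k * u)"
      using k by (simp add: X_def integral_diff i\<psi> mult_ac)
    then show "dist (\<Phi> y t) (\<Phi> y' t) \<le> 1/2 * dist y y'"
      by (simp add: \<Phi> T_def u_def[symmetric] dist_norm scaleR_diff_right[symmetric] exp_minus divide_simps)
  qed
  then obtain y where "\<Phi> y = y"
    using banach_fix_type[of "1/2" \<Phi>] by auto
  then have y: "apply_bcontfun y = T y" using \<Phi> by metis
  \<comment> \<open>At the fixed point, undoing the scaling of \<open>y\<close> gives back
    \<open>X y\<close>.\<close>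
  have "\<psi> y t = g (X y t)" if "0 \<le> t" for t
    using that by (simp add: \<psi>_def y T_def exp_minus max_absorb2)
  then have "(X y has_vector_derivative g (X y t)) (at t within {0..})" if "0 \<le> t" for t
    using dX[OF that, of y] that by simp
  then show ?thesis by (intro exI[of _ "X y"]) (auto simp: X_def[of y 0])
qed

section \<open>Quadratic Lyapunov functions\<close>

text \<open>First exit argument: at the first time with distance at least \<epsilon>, the lower
  bound forces \<open>V\<close> up to \<open>c1 * \<epsilon>\<^sup>2\<close>, but until then
  \<open>V\<close> has not increased. No differential equation is mentioned, so that the original
  and the projected field can both be treated.\<close>

lemma lyapunov_confinement:
  fixes x :: "real \<Rightarrow> 'a::euclidean_space"
  assumes cx: "continuous_on {0..} x" and \<epsilon>: "0 < \<epsilon>" "\<epsilon> \<le> r"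
    and V: "continuous_on UNIV V" "\<And>y. c1 * (norm (y - e))\<^sup>2 \<le> V y" and c1: "0 < c1"
    and dV: "\<And>t. t > 0 \<Longrightarrow> norm (x t - e) \<le> r \<Longrightarrow>
        \<exists>D. ((\<lambda>t. V (x t)) has_real_derivative D) (at t) \<and> D \<le> 0"
    and init: "norm (x 0 - e) < \<epsilon>" "V (x 0) < c1 * \<epsilon>\<^sup>2" and t: "0 \<le> t"
  shows "norm (x t - e) < \<epsilon>"
proof (rule ccontr)
  assume neg: "\<not> norm (x t - e) < \<epsilon>"
  define A where "A = {s \<in> {0..t}. \<epsilon> \<le> norm (x s - e)}"
  have ct: "continuous_on {0..s} x" for s by (rule continuous_on_subset[OF cx]) auto
  have "compact A"
  proof -
    have "closed A" unfolding A_def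
      by (intro continuous_on_closed_Collect_le continuous_intros ct)
    moreover have "bounded A" by (rule bounded_subset[of "{0..t}"]) (auto simp: A_def)
    ultimately show ?thesis by (simp add: compact_eq_bounded_closed)
  qed
  moreover have "A \<noteq> {}" using neg t by (auto simp: A_def)
  ultimately obtain s where s: "s \<in> A" "\<And>u. u \<in> A \<Longrightarrow> s \<le> u"
    using compact_attains_inf by metis
  have before: "norm (x u - e) \<le> r" if "u < s" "0 \<le> u" for u
    using s(2)[of u] s(1) that \<epsilon> by (force simp: A_def)
  have "V (x 0) \<ge> V (x s)"
  proof (rule DERIV_nonpos_imp_decreasing_open[where f = "\<lambda>t. V (x t)"])
    show "continuous_on {0..s} (\<lambda>t. V (x t))"
      by (rule continuous_on_compose2[OF V(1) ct]) auto
  qed (use s before dV in \<open>auto simp: A_def\<close>)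
  moreover have "c1 * \<epsilon>\<^sup>2 \<le> c1 * (norm (x s - e))\<^sup>2"
    using s(1) \<epsilon> c1 by (intro mult_left_mono power_mono) (auto simp: A_def)
  ultimately show False using V(2)[of "x s"] init by linarith
qed

text \<open>\<open>V x = \<beta> (x - e) (x - e)\<close> lies between two multiples of the squared
  distance, so its decrease turns into \<open>V' \<le> - (c / K) * V\<close> and exponential decay.
  As \<beta> may fail to be symmetric, the derivative of \<open>V\<close> appears as the sum over
  both argument orders.\<close>

theorem quadratic_lyapunov_asymptotically_stable:
  fixes F :: "'a::euclidean_space \<Rightarrow> 'a" and \<beta> :: "'a \<Rightarrow> 'a \<Rightarrow> real"
  assumes S: "\<And>x v. S x v \<longleftrightarrow> v = F x" and e: "F e = 0"
    and lip: "L-lipschitz_on (cball e r) F" and r: "0 < r"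
    and \<beta>: "bounded_bilinear \<beta>"
    and c1: "0 < c1" "\<And>y. c1 * (norm y)\<^sup>2 \<le> \<beta> y y"
    and c: "0 < c" "\<And>y. norm y \<le> r \<Longrightarrow> \<beta> y (F (e + y)) + \<beta> (F (e + y)) y \<le> - c * (norm y)\<^sup>2"
  shows "asymptotically_stable S e"
proof -
  interpret \<beta>: bounded_bilinear \<beta> by fact
  obtain K where K: "0 < K" "\<And>y z. norm (\<beta> y z) \<le> norm y * norm z * K"
    using \<beta>.pos_bounded by blast
  define V where "V x = \<beta> (x - e) (x - e)" for x
  have V_lo: "c1 * (norm (x - e))\<^sup>2 \<le> V x" for x by (simp add: V_def c1)
  have V_hi: "V x \<le> K * (norm (x - e))\<^sup>2" for x
    using K(2)[of "x - e" "x - e"] by (simp add: V_def power2_eq_square mult_ac)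
  have V_cont: "continuous_on UNIV V" unfolding V_def by (intro \<beta>.continuous_on continuous_intros)
  have V_deriv: "((\<lambda>t. V (x t)) has_real_derivative \<beta> (x t - e) v + \<beta> v (x t - e)) (at t within A)"
    if "(x has_vector_derivative v) (at t within A)" for x t v A
  proof -
    have "((\<lambda>t. x t - e) has_vector_derivative v) (at t within A)"
      using that by (auto intro!: derivative_eq_intros)
    from \<beta>.has_vector_derivative[OF this this] show ?thesis
      by (simp add: V_def has_real_derivative_iff_has_vector_derivative)
  qed
  have F_neg: "\<beta> (x - e) (F x) + \<beta> (F x) (x - e) \<le> - (c / K) * V x" if "norm (x - e) \<le> r" for x
  proof -
    have "(c / K) * V x \<le> (c / K) * (K * (norm (x - e))\<^sup>2)"
      using c K V_hi by (intro mult_left_mono) auto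
    then show ?thesis using c(2)[OF that] K(1) by simp
  qed
  have V_nonneg: "0 \<le> V x" for x using V_lo[of x] c1(1) by (smt (verit) mult_nonneg_nonneg zero_le_power2)
  \<comment> \<open>The square root makes \<open>K\<close> times the squared initial distance
    smaller than \<open>c1 * \<epsilon>\<^sup>2\<close>; the 1 in the minimum puts the start inside
    the \<epsilon>-ball.\<close>
  define \<delta> where "\<delta> \<epsilon> = \<epsilon> * min 1 (sqrt (c1 / K))" for \<epsilon>
  have \<delta>_pos: "0 < \<delta> \<epsilon>" if "0 < \<epsilon>" for \<epsilon> using that c1 K by (simp add: \<delta>_def)
  have \<delta>: "norm (x - e) < \<epsilon> \<and> V x < c1 * \<epsilon>\<^sup>2" if "norm (x - e) < \<delta> \<epsilon>" "0 < \<epsilon>" for x \<epsilon>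
  proof
    have "\<epsilon> * min 1 (sqrt (c1 / K)) \<le> \<epsilon> * 1" using that by (intro mult_left_mono) auto
    then show "norm (x - e) < \<epsilon>" using that unfolding \<delta>_def by linarith
    have "\<epsilon> * min 1 (sqrt (c1 / K)) \<le> \<epsilon> * sqrt (c1 / K)" using that by (intro mult_left_mono) auto
    then have "norm (x - e) < \<epsilon> * sqrt (c1 / K)" using that unfolding \<delta>_def by linarith
    then have "(norm (x - e))\<^sup>2 < (\<epsilon> * sqrt (c1 / K))\<^sup>2" by (intro power_strict_mono) auto
    also have "\<dots> = \<epsilon>\<^sup>2 * (c1 / K)" using c1 K by (simp add: power_mult_distrib)
    finally have "K * (norm (x - e))\<^sup>2 < c1 * \<epsilon>\<^sup>2" using K by (simp add: field_simps)
    then show "V x < c1 * \<epsilon>\<^sup>2" using V_hi[of x] by linarith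
  qed
  \<comment> \<open>\<open>G\<close> will be \<open>F\<close> itself for given trajectories, and
    \<open>F\<close> after projection to the ball when existence is shown.\<close>
  have confined: "norm (x t - e) < \<epsilon>"
    if x: "\<And>t. 0 \<le> t \<Longrightarrow> (x has_vector_derivative G (x t)) (at t within {0..})"
      and G: "\<And>y. norm (y - e) \<le> r \<Longrightarrow> G y = F y"
      and \<epsilon>: "0 < \<epsilon>" "\<epsilon> \<le> r" and init: "norm (x 0 - e) < \<delta> \<epsilon>" and t: "0 \<le> t" for x G \<epsilon> t
  proof (rule lyapunov_confinement[OF _ \<epsilon> V_cont V_lo c1(1)])
    show "continuous_on {0..} x"
      by (rule continuous_on_vector_derivative[where f' = "\<lambda>t. G (x t)"]) (use x in auto)
    show "norm (x 0 - e) < \<epsilon>" "V (x 0) < c1 * \<epsilon>\<^sup>2" using \<delta>[OF init \<epsilon>(1)] by auto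
    fix s :: real assume s: "s > 0" "norm (x s - e) \<le> r"
    have "at s within {0..} = at s" using s by (intro at_within_interior) auto
    then have "((\<lambda>t. V (x t)) has_real_derivative \<beta> (x s - e) (F (x s)) + \<beta> (F (x s)) (x s - e)) (at s)"
      using V_deriv[OF x[of s]] G[OF s(2)] s by auto
    moreover have "0 \<le> c / K * V (x s)" using c K V_nonneg by simp
    ultimately show "\<exists>D. ((\<lambda>t. V (x t)) has_real_derivative D) (at s) \<and> D \<le> 0"
      using F_neg[OF s(2)] by (intro exI conjI) auto
  qed (use t in simp)
  have traj: "trajectory S x \<longleftrightarrow> (\<forall>t\<ge>0. (x has_vector_derivative F (x t)) (at t within {0..}))" for x
    by (auto simp: trajectory_def S)
  have exist: "\<exists>x. trajectory S x \<and> x 0 = x0" if x0: "norm (x0 - e) < \<delta> r" for x0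
  proof -
    \<comment> \<open>Projection to a closed convex set is nonexpansive, so the composed field is
      globally Lipschitz with the same constant; it is bounded because the ball is compact.\<close>
    let ?p = "closest_point (cball e r)"
    have p_in: "?p x \<in> cball e r" for x using r by (intro closest_point_in_set) auto
    have lip': "L-lipschitz_on UNIV (\<lambda>x. F (?p x))"
    proof (rule lipschitz_onI)
      show L: "0 \<le> L" by (rule lipschitz_on_nonneg[OF lip])
      fix x y
      have "dist (F (?p x)) (F (?p y)) \<le> L * dist (?p x) (?p y)"
        by (rule lipschitz_onD[OF lip p_in p_in])
      also have "\<dots> \<le> L * dist x y"
        using r L by (intro mult_left_mono closest_point_lipschitz) auto
      finally show "dist (F (?p x)) (F (?p y)) \<le> L * dist x y" .
    qed
    have "bounded (F ` cball e r)"
      by (intro compact_imp_bounded compact_continuous_image lipschitz_on_continuous_on[OF lip]) auto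
    then have "bounded (range (\<lambda>x. F (?p x)))" by (rule bounded_subset) (use p_in in auto)
    from lipschitz_bounded_ode_solution[OF lip' this, of x0] obtain x where x: "x 0 = x0"
      "\<And>t. 0 \<le> t \<Longrightarrow> (x has_vector_derivative F (?p (x t))) (at t within {0..})" by blast
    have p_id: "F (?p y) = F y" if "norm (y - e) \<le> r" for y
      using that by (subst closest_point_self) (auto simp: dist_norm norm_minus_commute)
    have "norm (x t - e) < r" if "0 \<le> t" for t
      using confined[where G = "\<lambda>x. F (?p x)", OF x(2) p_id r order_refl _ that] x(1) x0 by auto
    then have "trajectory S x" unfolding traj using x(2) p_id by (metis less_imp_le)
    then show ?thesis using x(1) by blast
  qed
  have stable: "stable_equilibrium S e"
    unfolding stable_equilibrium_def
  proof (intro conjI allI impI)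
    show "equilibrium S e" by (simp add: equilibrium_def S e)
    fix \<epsilon> :: real assume \<epsilon>: "0 < \<epsilon>"
    define \<eta> where "\<eta> = min \<epsilon> r"
    have \<eta>: "0 < \<eta>" "\<eta> \<le> r" "\<eta> \<le> \<epsilon>" using \<epsilon> r by (auto simp: \<eta>_def)
    have \<delta>\<eta>: "\<delta> \<eta> \<le> \<delta> r" unfolding \<delta>_def using \<eta> c1 K by (intro mult_right_mono) auto
    show "\<exists>\<delta>>0. \<forall>x0. dist x0 e < \<delta> \<longrightarrow> (\<exists>x. trajectory S x \<and> x 0 = x0) \<and>
        (\<forall>x. trajectory S x \<and> x 0 = x0 \<longrightarrow> (\<forall>t\<ge>0. dist (x t) e < \<epsilon>))"
    proof (intro exI[of _ "\<delta> \<eta>"] conjI allI impI \<delta>_pos \<eta>)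
      fix x0 assume x0: "dist x0 e < \<delta> \<eta>"
      then show "\<exists>x. trajectory S x \<and> x 0 = x0" using exist \<delta>\<eta> by (simp add: dist_norm)
      fix x t assume "trajectory S x \<and> x 0 = x0" "(0::real) \<le> t"
      then show "dist (x t) e < \<epsilon>"
        using confined[of x F \<eta> t] x0 \<eta> by (force simp: traj dist_norm)
    qed
  qed
  have "(x \<longlongrightarrow> e) at_top" if x: "trajectory S x" "norm (x 0 - e) < \<delta> r" for x
  proof -
    define \<kappa> where "\<kappa> = c / K"
    have \<kappa>: "0 < \<kappa>" using c K by (simp add: \<kappa>_def)
    have dx: "(x has_vector_derivative F (x t)) (at t within {0..})" if "0 \<le> t" for t
      using x that by (auto simp: traj)
    have cx: "continuous_on {0..} x"
      by (rule continuous_on_vector_derivative[where f' = "\<lambda>t. F (x t)"]) (use dx in auto)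
    have conf: "norm (x t - e) \<le> r" if "0 \<le> t" for t
      using confined[OF dx _ r order_refl x(2) that] by auto
    \<comment> \<open>Integrating factor: the differential inequality for \<open>V\<close> says that
      \<open>exp (\<kappa> * t) * V (x t)\<close> does not increase.\<close>
    have decay: "exp (\<kappa> * t) * V (x t) \<le> V (x 0)" if "0 \<le> t" for t
    proof -
      have "exp (\<kappa> * 0) * V (x 0) \<ge> exp (\<kappa> * t) * V (x t)"
      proof (rule DERIV_nonpos_imp_decreasing_open[OF that])
        show "continuous_on {0..t} (\<lambda>t. exp (\<kappa> * t) * V (x t))"
          by (intro continuous_intros continuous_on_compose2[OF V_cont] continuous_on_subset[OF cx]) auto
        fix s :: real assume s: "0 < s" "s < t"
        let ?D = "\<beta> (x s - e) (F (x s)) + \<beta> (F (x s)) (x s - e)"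
        have "at s within {0..} = at s" using s by (intro at_within_interior) auto
        then have "((\<lambda>t. V (x t)) has_real_derivative ?D) (at s)"
          using V_deriv[OF dx[of s]] s by auto
        then have "((\<lambda>t. exp (\<kappa> * t) * V (x t)) has_real_derivative
            exp (\<kappa> * s) * (\<kappa> * V (x s) + ?D)) (at s)"
          by (auto intro!: derivative_eq_intros simp: algebra_simps)
        moreover have "\<kappa> * V (x s) + ?D \<le> 0"
          using F_neg[OF conf[of s]] s by (simp add: \<kappa>_def)
        ultimately show "\<exists>D. ((\<lambda>t. exp (\<kappa> * t) * V (x t)) has_real_derivative D) (at s) \<and> D \<le> 0"
          by (intro exI[of _ "exp (\<kappa> * s) * (\<kappa> * V (x s) + ?D)"] conjI)
            (auto intro!: mult_nonneg_nonpos)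
      qed
      then show ?thesis by simp
    qed
    have bound: "(norm (x t - e))\<^sup>2 \<le> V (x 0) / c1 * exp (- \<kappa> * t)" if "0 \<le> t" for t
    proof -
      have "exp (\<kappa> * t) * (c1 * (norm (x t - e))\<^sup>2) \<le> exp (\<kappa> * t) * V (x t)"
        by (intro mult_left_mono V_lo) auto
      with decay[OF that] have "exp (\<kappa> * t) * (c1 * (norm (x t - e))\<^sup>2) \<le> V (x 0)" by linarith
      then show ?thesis using c1 by (simp add: exp_minus field_simps)
    qed
    have "filterlim (\<lambda>t. - \<kappa> * t) at_bot at_top"
      using \<kappa> by (intro filterlim_tendsto_neg_mult_at_bot[OF tendsto_const _ filterlim_ident]) simp
    then have "((\<lambda>t. exp (- \<kappa> * t)) \<longlongrightarrow> 0) at_top"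
      by (rule filterlim_compose[OF exp_at_bot])
    then have lim: "((\<lambda>t. V (x 0) / c1 * exp (- \<kappa> * t)) \<longlongrightarrow> 0) at_top"
      by (rule tendsto_mult_right_zero)
    have "((\<lambda>t. (norm (x t - e))\<^sup>2) \<longlongrightarrow> 0) at_top"
      by (rule tendsto_sandwich[OF _ _ tendsto_const lim])
        (auto intro!: eventually_at_top_linorderI[of 0] bound[simplified])
    then have "((\<lambda>t. norm (x t - e)) \<longlongrightarrow> 0) at_top"
      using tendsto_real_sqrt[of "\<lambda>t. (norm (x t - e))\<^sup>2" 0 at_top] by simp
    then show ?thesis by (simp add: tendsto_norm_zero_iff LIM_zero_iff)
  qed
  then have "locally_attractive S e"
    unfolding locally_attractive_def using \<delta>_pos[OF r] by (auto simp: dist_norm)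
  with stable show ?thesis by (simp add: asymptotically_stable_def)
qed

section \<open>Lipschitz continuity without explicit constants\<close>

lemma bounded_lipschitz_image:
  assumes "L-lipschitz_on X f" "bounded X"
  shows "bounded (f ` X)"
proof (cases "X = {}")
  case False
  then obtain a where a: "a \<in> X" by blast
  obtain d where "\<And>x. x \<in> X \<Longrightarrow> dist a x \<le> d" using assms(2) bounded_any_center by metis
  then have "dist (f a) (f x) \<le> L * d" if "x \<in> X" for x
    using lipschitz_onD[OF assms(1) a that] lipschitz_on_nonneg[OF assms(1)] that
    by (meson mult_left_mono order_trans)
  then show ?thesis unfolding bounded_def by blast
qed simp

text \<open>Hiding the constant lets the closure properties act as introduction rules that follow
  the syntax of the closed-loop field.\<close>

definition lipschitzian_on :: "'a::metric_space set \<Rightarrow> ('a \<Rightarrow> 'b::metric_space) \<Rightarrow> bool" where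
  "lipschitzian_on X f \<longleftrightarrow> (\<exists>L. L-lipschitz_on X f)"

named_theorems lipschitzian_intros

lemma lipschitzian_on_id [lipschitzian_intros]: "lipschitzian_on X (\<lambda>x. x)"
  and lipschitzian_on_const [lipschitzian_intros]: "lipschitzian_on X (\<lambda>x. c)"
  unfolding lipschitzian_on_def by (blast intro: lipschitz_intros)+

lemma lipschitzian_on_add [lipschitzian_intros]:
  "lipschitzian_on X f \<Longrightarrow> lipschitzian_on X g \<Longrightarrow> lipschitzian_on X (\<lambda>x. f x + g x)"
  and lipschitzian_on_diff [lipschitzian_intros]:
  "lipschitzian_on X f \<Longrightarrow> lipschitzian_on X g \<Longrightarrow> lipschitzian_on X (\<lambda>x. f x - g x)"
  and lipschitzian_on_minus [lipschitzian_intros]: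
  "lipschitzian_on X f \<Longrightarrow> lipschitzian_on X (\<lambda>x. - f x)"
  for f :: "'a::metric_space \<Rightarrow> 'b::real_normed_vector"
  unfolding lipschitzian_on_def by (blast intro: lipschitz_intros)+

lemma lipschitzian_on_Pair [lipschitzian_intros]:
  "lipschitzian_on X f \<Longrightarrow> lipschitzian_on X g \<Longrightarrow> lipschitzian_on X (\<lambda>x. (f x, g x))"
  unfolding lipschitzian_on_def by (blast intro: lipschitz_intros)

lemma lipschitzian_on_compose:
  "lipschitzian_on (f ` X) g \<Longrightarrow> lipschitzian_on X f \<Longrightarrow> lipschitzian_on X (\<lambda>x. g (f x))"
  unfolding lipschitzian_on_def by (blast intro: lipschitz_on_compose2)

lemma lipschitzian_on_bounded_linear:
  assumes "bounded_linear h" "lipschitzian_on X f"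
  shows "lipschitzian_on X (\<lambda>x. h (f x))"
proof -
  have "lipschitzian_on (f ` X) h"
    using bounded_linear.lipschitz_boundE[OF assms(1)] unfolding lipschitzian_on_def by metis
  then show ?thesis using assms(2) by (rule lipschitzian_on_compose)
qed

lemmas lipschitzian_on_fst [lipschitzian_intros] = lipschitzian_on_bounded_linear[OF bounded_linear_fst]
  and lipschitzian_on_snd [lipschitzian_intros] = lipschitzian_on_bounded_linear[OF bounded_linear_snd]
  and lipschitzian_on_matrix_vector_mult [lipschitzian_intros] =
    lipschitzian_on_bounded_linear[OF matrix_vector_mul_bounded_linear]

text \<open>The difference is split so that one argument changes at a time; the other factor is
  bounded because a Lipschitz function maps bounded sets to bounded sets.\<close>

lemma lipschitzian_on_bounded_bilinear:
  assumes h: "bounded_bilinear h" and X: "bounded X"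
    and f: "lipschitzian_on X f" and g: "lipschitzian_on X g"
  shows "lipschitzian_on X (\<lambda>x. h (f x) (g x))"
proof -
  interpret h: bounded_bilinear h by fact
  obtain K where K: "0 \<le> K" "\<And>a b. norm (h a b) \<le> norm a * norm b * K"
    using h.nonneg_bounded by blast
  from f g obtain Lf Lg where L: "Lf-lipschitz_on X f" "Lg-lipschitz_on X g"
    by (auto simp: lipschitzian_on_def)
  then have L0: "0 \<le> Lf" "0 \<le> Lg" by (auto dest: lipschitz_on_nonneg)
  from bounded_lipschitz_image[OF L(1) X] bounded_lipschitz_image[OF L(2) X]
  obtain Mf Mg where M: "\<And>x. x \<in> X \<Longrightarrow> norm (f x) \<le> Mf" "\<And>x. x \<in> X \<Longrightarrow> norm (g x) \<le> Mg"
    "0 < Mf" "0 < Mg"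
    by (auto simp: bounded_pos)
  have "(Lf * Mg * K + Mf * Lg * K)-lipschitz_on X (\<lambda>x. h (f x) (g x))"
  proof (rule lipschitz_onI)
    fix x y assume xy: "x \<in> X" "y \<in> X"
    have "h (f x) (g x) - h (f y) (g y) = h (f x - f y) (g x) + h (f y) (g x - g y)"
      by (simp add: h.diff_left h.diff_right)
    then have "norm (h (f x) (g x) - h (f y) (g y)) \<le>
        norm (f x - f y) * norm (g x) * K + norm (f y) * norm (g x - g y) * K"
      using norm_triangle_ineq[of "h (f x - f y) (g x)" "h (f y) (g x - g y)"]
        K(2)[of "f x - f y" "g x"] K(2)[of "f y" "g x - g y"] by simp
    also have "\<dots> \<le> (Lf * dist x y) * Mg * K + Mf * (Lg * dist x y) * K"
      using K(1) L0 M xy lipschitz_onD[OF L(1) xy] lipschitz_onD[OF L(2) xy]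
      by (intro add_mono mult_mono) (auto simp: dist_norm)
    finally show "dist (h (f x) (g x)) (h (f y) (g y)) \<le> (Lf * Mg * K + Mf * Lg * K) * dist x y"
      by (simp add: dist_norm algebra_simps)
  qed (use K L0 M in simp)
  then show ?thesis by (auto simp: lipschitzian_on_def)
qed

text \<open>Mean value inequality on a closed ball containing \<open>X\<close>: convexity of the
  ball permits it, and compactness bounds the continuous derivative there.\<close>

lemma continuously_differentiable_lipschitzian_on:
  fixes f :: "real ^ 'n \<Rightarrow> real ^ 'm"
  assumes "continuously_differentiable f" "bounded X"
  shows "lipschitzian_on X f"
proof -
  obtain Df where Df: "\<And>x. (f has_derivative (\<lambda>h. Df x *v h)) (at x)" "continuous_on UNIV Df"
    using assms(1) by (auto simp: continuously_differentiable_def)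
  obtain r where r: "X \<subseteq> cball 0 r" using assms(2) by (auto simp: bounded_iff subset_eq)
  have bil: "bounded_bilinear (\<lambda>(A::real^'n^'m) x. A *v x)"
    unfolding bilinear_conv_bounded_bilinear[symmetric] bilinear_def
    by (auto intro!: linearI simp: matrix_vector_right_distrib matrix_vector_mult_add_rdistrib
        matrix_vector_mult_scaleR scaleR_matrix_vector_assoc)
  obtain K where K: "0 < K" "\<And>(A::real^'n^'m) x. norm (A *v x) \<le> norm A * norm x * K"
    using bounded_bilinear.pos_bounded[OF bil] by blast
  have "bounded (Df ` cball 0 r)"
    by (intro compact_imp_bounded compact_continuous_image continuous_on_subset[OF Df(2)]) auto
  then obtain M where M: "0 < M" "\<And>x. x \<in> cball 0 r \<Longrightarrow> norm (Df x) \<le> M"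
    by (auto simp: bounded_pos)
  have "(M * K)-lipschitz_on (cball 0 r) f"
  proof (rule lipschitz_onI)
    fix x y :: "real ^ 'n" assume "x \<in> cball 0 r" "y \<in> cball 0 r"
    moreover have "onorm (\<lambda>h. Df z *v h) \<le> M * K" if "z \<in> cball 0 r" for z
    proof (rule onorm_le)
      fix h :: "real ^ 'n"
      have "norm (Df z) * norm h * K \<le> M * norm h * K"
        using M(2)[OF that] K(1) by (intro mult_right_mono) auto
      then show "norm (Df z *v h) \<le> M * K * norm h" using K(2)[of "Df z" h] by (simp add: mult_ac)
    qed
    ultimately show "dist (f x) (f y) \<le> M * K * dist x y"
      unfolding dist_norm
      by (intro differentiable_bound[where f' = "\<lambda>x h. Df x *v h" and S = "cball 0 r"])
        (auto intro: has_derivative_at_withinI Df)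
  qed (use M K in simp)
  then show ?thesis using r lipschitz_on_subset unfolding lipschitzian_on_def by blast
qed

section \<open>Matrices\<close>

lemma W_mult: "W q *v x = (\<chi> i. \<bar>q $ i\<bar> * q $ i * x $ i)"
  by (simp add: W_def vec_eq_iff matrix_vector_mult_def if_distrib [where f="\<lambda>x. x * _"] cong: if_cong)

text \<open>The result is an iterated componentwise product of the vectors of absolute values of
  \<open>q\<close>, of \<open>q\<close> and of \<open>y\<close>; the absolute value enters as a
  1-Lipschitz map.\<close>

lemma lipschitzian_on_W_mult:
  fixes q y :: "'a::metric_space \<Rightarrow> real ^ 'n"
  assumes X: "bounded X" and q: "lipschitzian_on X q" and y: "lipschitzian_on X y"
  shows "lipschitzian_on X (\<lambda>x. W (q x) *v y x)"
proof -
  define h where "h = (\<lambda>(u::real^'n) v. \<chi> i. u $ i * v $ i)"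
  have h: "bounded_bilinear h"
    unfolding bilinear_conv_bounded_bilinear[symmetric] bilinear_def h_def
    by (auto intro!: linearI simp: vec_eq_iff algebra_simps)
  have "1-lipschitz_on (q ` X) (\<lambda>u. \<chi> i. \<bar>u $ i\<bar>)"
    by (rule lipschitz_onI) (auto simp: dist_norm intro!: norm_le_componentwise_cart abs_triangle_ineq3)
  then have "lipschitzian_on X (\<lambda>x. \<chi> i. \<bar>q x $ i\<bar>)"
    using lipschitzian_on_compose[OF _ q, of "\<lambda>u. \<chi> i. \<bar>u $ i\<bar>"] by (auto simp: lipschitzian_on_def)
  then have "lipschitzian_on X (\<lambda>x. h (h (\<chi> i. \<bar>q x $ i\<bar>) (q x)) (y x))"
    by (intro lipschitzian_on_bounded_bilinear[OF h X] q y)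
  then show ?thesis by (simp add: h_def W_mult)
qed

lemma norm_W_mult_le: "norm (W q *v x) \<le> (norm q)\<^sup>2 * norm x"
proof -
  have "norm (W q *v x) \<le> norm ((norm q)\<^sup>2 *\<^sub>R x)"
  proof (rule norm_le_componentwise_cart)
    fix i
    have "\<bar>q $ i\<bar> * \<bar>q $ i\<bar> * \<bar>x $ i\<bar> \<le> norm q * norm q * \<bar>x $ i\<bar>"
      by (intro mult_mono component_le_norm_cart) auto
    then show "norm ((W q *v x) $ i) \<le> norm (((norm q)\<^sup>2 *\<^sub>R x) $ i)"
      by (simp add: W_mult abs_mult power2_eq_square)
  qed
  then show ?thesis by simp
qed

section \<open>Symmetric and positive definite matrices, operator norm bounds\<close>

lemma matrix_vector_mult_minus: "A *v (- x) = - (A *v x)" for A :: "real ^ 'n ^ 'm"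
  by (rule linear_neg) simp

lemma inner_symmetric_matrix:
  assumes "symmetric_matrix A"
  shows "(A *v x) \<bullet> y = x \<bullet> (A *v y)"
  using assms by (metis dot_lmul_matrix symmetric_matrix_def vector_transpose_matrix inner_commute)

lemma diagonal_imp_symmetric_matrix: "diagonal_matrix A \<Longrightarrow> symmetric_matrix A"
  unfolding diagonal_matrix_def symmetric_matrix_def transpose_def vec_eq_iff
  by (metis vec_lambda_beta)

lemma symmetric_matrix_W: "symmetric_matrix (W q)"
  by (intro diagonal_imp_symmetric_matrix) (simp add: diagonal_matrix_def W_def)

text \<open>The quadratic form attains a positive minimum on the compact unit sphere; homogeneity of
  degree two extends the bound to all vectors.\<close>

lemma positive_definite_coercive:
  fixes A :: "real ^ 'n ^ 'n"
  assumes "positive_definite A"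
  shows "\<exists>m>0. \<forall>x. m * (norm x)\<^sup>2 \<le> x \<bullet> (A *v x)"
proof -
  have "\<exists>x\<in>sphere (0::real^'n) 1. \<forall>y\<in>sphere 0 1. x \<bullet> (A *v x) \<le> y \<bullet> (A *v y)"
    by (intro continuous_attains_inf continuous_intros matrix_vector_mult_linear_continuous_on) auto
  then obtain x where x: "norm x = 1" "\<And>y. norm y = 1 \<Longrightarrow> x \<bullet> (A *v x) \<le> y \<bullet> (A *v y)"
    by auto
  have "x \<bullet> (A *v x) * (norm y)\<^sup>2 \<le> y \<bullet> (A *v y)" for y
  proof (cases "y = 0")
    case False
    have "x \<bullet> (A *v x) \<le> (y /\<^sub>R norm y) \<bullet> (A *v (y /\<^sub>R norm y))"
      using False by (intro x(2)) simp
    also have "\<dots> = y \<bullet> (A *v y) / (norm y)\<^sup>2"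
      by (simp add: matrix_vector_mult_scaleR power2_eq_square divide_inverse)
    finally show ?thesis using False by (simp add: field_simps)
  qed simp
  moreover have "0 < x \<bullet> (A *v x)"
    using assms x(1) unfolding positive_definite_def by (metis norm_zero zero_neq_one)
  ultimately show ?thesis by blast
qed

text \<open>Definiteness makes the kernel trivial, and with \<open>y = A' *v x\<close> one has
  \<open>x \<bullet> (A' *v x) = y \<bullet> (A *v y)\<close>. Inverses of \<open>Jch\<close> and
  \<open>Jpr\<close> give an explicit vector field; those of \<open>Mch\<close>, \<open>Ma\<close>,
  \<open>Mb\<close> are weights of the energy.\<close>

lemma positive_definite_inverse:
  fixes A :: "real ^ 'n ^ 'n"
  assumes "positive_definite A"
  obtains A' where "\<And>x. A' *v (A *v x) = x" "\<And>x. A *v (A' *v x) = x"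
    "symmetric_matrix A \<Longrightarrow> symmetric_matrix A'" "positive_definite A'"
proof -
  have "\<exists>A'. A' ** A = mat 1"
    using assms unfolding matrix_left_invertible_ker positive_definite_def
    by (metis inner_zero_right less_irrefl)
  then obtain A' where A': "A' ** A = mat 1" "A ** A' = mat 1"
    using matrix_left_right_inverse by blast
  have inv: "A' *v (A *v x) = x" "A *v (A' *v x) = x" for x
    using A' by (simp_all add: matrix_vector_mul_assoc)
  have "positive_definite A'"
    unfolding positive_definite_def
  proof (intro allI impI)
    fix x :: "real ^ 'n" assume "x \<noteq> 0"
    then have "A' *v x \<noteq> 0" using inv(2)[of x] by auto
    then have "0 < (A' *v x) \<bullet> (A *v (A' *v x))" using assms by (auto simp: positive_definite_def)
    then show "0 < x \<bullet> (A' *v x)" by (simp add: inv inner_commute)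
  qed
  moreover have "symmetric_matrix A'" if "symmetric_matrix A"
    using that A' unfolding symmetric_matrix_def
    by (metis matrix_mul_assoc matrix_mul_lid matrix_mul_rid matrix_transpose_mul transpose_mat)
  ultimately show ?thesis using inv that by blast
qed

text \<open>Taking arbitrary bounds instead of the norms themselves lets estimates of nested matrix
  products be chained.\<close>

lemma inner_matrix_bound:
  fixes A :: "real ^ 'n ^ 'm"
  assumes "norm x \<le> \<alpha>" "norm y \<le> \<gamma>"
  shows "\<bar>x \<bullet> (A *v y)\<bar> \<le> onorm ((*v) A) * (\<alpha> * \<gamma>)"
proof -
  have "\<bar>x \<bullet> (A *v y)\<bar> \<le> norm x * norm (A *v y)" by (rule Cauchy_Schwarz_ineq2)
  also have "\<dots> \<le> norm x * (onorm ((*v) A) * norm y)"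
    by (intro mult_left_mono onorm) auto
  also have "\<dots> \<le> \<alpha> * (onorm ((*v) A) * \<gamma>)"
    using assms order_trans[OF norm_ge_zero assms(1)]
    by (intro mult_mono) (auto intro!: mult_nonneg_nonneg onorm_pos_le)
  finally show ?thesis by (simp add: mult_ac)
qed

lemma norm_matrix_vector_mult_bound:
  fixes A :: "real ^ 'n ^ 'm"
  assumes "norm y \<le> \<gamma>"
  shows "norm (A *v y) \<le> onorm ((*v) A) * \<gamma>"
  by (rule order_trans[OF onorm mult_left_mono]) (use assms in \<open>auto intro!: onorm_pos_le\<close>)

section \<open>Lyapunov estimates\<close>

text \<open>Here \<open>u\<close> will be the norm of the damped variables \<open>(p, z, v)\<close>
  and \<open>w\<close> that of \<open>(s, a, b)\<close>. Young's inequality splits the mixed term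
  into half of \<open>m * w\<^sup>2\<close> and a multiple of \<open>u\<^sup>2\<close>, which
  \<open>k * u\<^sup>2\<close> dominates for small \<epsilon>. The bound
  \<open>\<epsilon> * C \<le> \<mu>\<close> will keep the perturbed form positive definite.\<close>

lemma cross_term_absorption:
  fixes k m C \<mu> :: real
  assumes "0 < k" "0 < m" "0 \<le> C" "0 < \<mu>"
  obtains \<epsilon> \<kappa> where "0 < \<epsilon>" "0 < \<kappa>" "\<epsilon> * C \<le> \<mu>"
    "\<And>u w. - k * u\<^sup>2 - \<epsilon> * (m * w\<^sup>2 - C * (u * w) - C * u\<^sup>2) \<le> - \<kappa> * (u\<^sup>2 + w\<^sup>2)"
proof -
  \<comment> \<open>The coefficient of \<open>u\<^sup>2\<close> left by Young's inequality, plus 1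
    to make it safely positive. Taking \<epsilon> at most \<open>k / (2 * D)\<close> then spends
    only half of the damping.\<close>
  define D where "D = C + C\<^sup>2 / (2 * m) + 1"
  have D: "1 \<le> D" using assms by (simp add: D_def)
  define \<epsilon> where "\<epsilon> = min (\<mu> / (C + 1)) (k / (2 * D))"
  define \<kappa> where "\<kappa> = min (k / 2) (\<epsilon> * m / 2)"
  have \<epsilon>: "0 < \<epsilon>" using assms D by (simp add: \<epsilon>_def)
  have \<kappa>: "0 < \<kappa>" using assms \<epsilon> by (simp add: \<kappa>_def)
  have "\<epsilon> * C \<le> \<epsilon> * (C + 1)" using \<epsilon> by simp
  also have "\<dots> \<le> \<mu> / (C + 1) * (C + 1)" using assms by (intro mult_right_mono) (auto simp: \<epsilon>_def)
  finally have \<epsilon>C: "\<epsilon> * C \<le> \<mu>" using assms by simp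
  have "\<epsilon> * D \<le> k / (2 * D) * D" using D by (intro mult_right_mono) (auto simp: \<epsilon>_def)
  then have \<epsilon>D: "\<epsilon> * D \<le> k / 2" using D by simp
  have "- k * u\<^sup>2 - \<epsilon> * (m * w\<^sup>2 - C * (u * w) - C * u\<^sup>2) \<le> - \<kappa> * (u\<^sup>2 + w\<^sup>2)" for u w
  proof -
    have "0 \<le> (m * w - C * u)\<^sup>2 / (2 * m)" using assms by simp
    also have "\<dots> = m / 2 * w\<^sup>2 - C * (u * w) + C\<^sup>2 / (2 * m) * u\<^sup>2"
      using assms by (simp add: power2_eq_square field_simps)
    finally have "C * (u * w) \<le> m / 2 * w\<^sup>2 + C\<^sup>2 / (2 * m) * u\<^sup>2" by simp
    moreover have "(C + C\<^sup>2 / (2 * m)) * u\<^sup>2 \<le> D * u\<^sup>2" by (intro mult_right_mono) (auto simp: D_def)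
    ultimately have "m / 2 * w\<^sup>2 - D * u\<^sup>2 \<le> m * w\<^sup>2 - C * (u * w) - C * u\<^sup>2"
      by (simp add: algebra_simps)
    then have "\<epsilon> * (m / 2 * w\<^sup>2 - D * u\<^sup>2) \<le> \<epsilon> * (m * w\<^sup>2 - C * (u * w) - C * u\<^sup>2)"
      using \<epsilon> by (intro mult_left_mono) auto
    then have "- k * u\<^sup>2 - \<epsilon> * (m * w\<^sup>2 - C * (u * w) - C * u\<^sup>2) \<le>
        - k * u\<^sup>2 - \<epsilon> * m / 2 * w\<^sup>2 + (\<epsilon> * D) * u\<^sup>2"
      by (simp add: algebra_simps)
    moreover have "(\<epsilon> * D) * u\<^sup>2 \<le> k / 2 * u\<^sup>2" using \<epsilon>D by (intro mult_right_mono) auto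
    moreover have "\<kappa> * u\<^sup>2 \<le> k / 2 * u\<^sup>2" "\<kappa> * w\<^sup>2 \<le> \<epsilon> * m / 2 * w\<^sup>2"
      by (intro mult_right_mono; simp add: \<kappa>_def)+
    ultimately show ?thesis by (simp add: algebra_simps)
  qed
  with \<epsilon> \<kappa> \<epsilon>C show ?thesis using that by blast
qed

text \<open>
  Primes denote velocities, \<open>\<phi>\<close> is the increment of \<open>fch\<close>, and \<open>D\<close> and \<open>D0\<close> play the roles of
  \<open>W\<close> and \<open>W0\<close>.
\<close>

lemma energy_dissipation:
  fixes Jch Mch Mchi Nch :: "real ^ 'ch ^ 'ch" and Jpr Npr Nsh Ma Mai Mb Mbi :: "real ^ 'pr ^ 'pr"
    and B :: "real ^ 'ch ^ 'pr"
  assumes Mchi: "\<And>x. Mchi *v (Mch *v x) = x" and Mai: "\<And>x. Mai *v (Ma *v x) = x"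
    and Mbi: "\<And>x. Mbi *v (Mb *v x) = x"
    and Nch: "positive_definite Nch" and Npr: "positive_definite Npr" and Nsh: "positive_definite Nsh"
  obtains c k where "0 < c" "0 < k"
    "\<And>p s z v a b p' s' z' v' a' b' \<phi> D.
      Jch *v p' = \<phi> - Nch *v p + s \<Longrightarrow> s' = - (Mch *v p) \<Longrightarrow>
      Jpr *v z' = D *v b - v - Npr *v z \<Longrightarrow> v' = z + a - Nsh *v v - B *v p \<Longrightarrow>
      a' = - (Ma *v v) \<Longrightarrow> b' = - (Mb *v (D *v z)) \<Longrightarrow> symmetric_matrix D \<Longrightarrow> p \<bullet> \<phi> \<le> 0 \<Longrightarrow>
      c * (p \<bullet> (Jch *v p') + s \<bullet> (Mchi *v s')) +
        (z \<bullet> (Jpr *v z') + v \<bullet> v' + a \<bullet> (Mai *v a') + b \<bullet> (Mbi *v b'))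
      \<le> - k * ((norm p)\<^sup>2 + (norm z)\<^sup>2 + (norm v)\<^sup>2)"
proof -
  obtain \<nu> where \<nu>: "0 < \<nu>" "\<And>x. \<nu> * (norm x)\<^sup>2 \<le> x \<bullet> (Nch *v x)"
    using positive_definite_coercive[OF Nch] by blast
  obtain n1 where n1: "0 < n1" "\<And>x. n1 * (norm x)\<^sup>2 \<le> x \<bullet> (Npr *v x)"
    using positive_definite_coercive[OF Npr] by blast
  obtain n2 where n2: "0 < n2" "\<And>x. n2 * (norm x)\<^sup>2 \<le> x \<bullet> (Nsh *v x)"
    using positive_definite_coercive[OF Nsh] by blast
  define \<gamma> where "\<gamma> = onorm ((*v) B)"
  \<comment> \<open>The network energy is weighted so that its damping \<open>c * \<nu>\<close> pays
    for the coupling \<open>v \<bullet> (B *v p)\<close>, whose other half costs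
    \<open>n2 / 2\<close> of the damping of \<open>v\<close>, and still leaves 1.\<close>
  define c where "c = (\<gamma>\<^sup>2 / (2 * n2) + 1) / \<nu>"
  define k where "k = min 1 (min n1 (n2 / 2))"
  have c: "0 < c" using \<nu> n2 by (auto simp: c_def intro!: divide_pos_pos add_nonneg_pos)
  have k: "0 < k" using n1 n2 by (simp add: k_def)
  have k_le: "k \<le> 1" "k \<le> n1" "k \<le> n2 / 2" by (auto simp: k_def)
  show ?thesis
  proof (rule that[OF c k])
    fix p s z v a b p' s' z' v' a' b' \<phi> and D :: "real ^ 'pr ^ 'pr"
    assume eqs: "Jch *v p' = \<phi> - Nch *v p + s" "s' = - (Mch *v p)"
      "Jpr *v z' = D *v b - v - Npr *v z" "v' = z + a - Nsh *v v - B *v p"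
      "a' = - (Ma *v v)" "b' = - (Mb *v (D *v z))" and D: "symmetric_matrix D" and \<phi>: "p \<bullet> \<phi> \<le> 0"
    have Dzb: "b \<bullet> (D *v z) = z \<bullet> (D *v b)"
      using inner_symmetric_matrix[OF D] by (metis inner_commute)
    \<comment> \<open>The exchange terms in \<open>s \<bullet> p\<close>,
      \<open>z \<bullet> v\<close>, \<open>v \<bullet> a\<close> and, by symmetry of
      \<open>D\<close>, \<open>z \<bullet> (D *v b)\<close> cancel in pairs; damping, \<phi> and the
      coupling through \<open>B\<close> survive.\<close>
    have "c * (p \<bullet> (Jch *v p') + s \<bullet> (Mchi *v s')) +
        (z \<bullet> (Jpr *v z') + v \<bullet> v' + a \<bullet> (Mai *v a') + b \<bullet> (Mbi *v b')) =
        c * (p \<bullet> \<phi> - p \<bullet> (Nch *v p)) - z \<bullet> (Npr *v z) - v \<bullet> (Nsh *v v) - v \<bullet> (B *v p)"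
      unfolding eqs
      by (simp add: matrix_vector_mult_minus Mchi Mai Mbi inner_add_right inner_diff_right
          inner_commute[of v z] inner_commute[of v a] inner_commute[of s p]
          Dzb)
    also have "\<dots> \<le> c * (0 - \<nu> * (norm p)\<^sup>2) - n1 * (norm z)\<^sup>2 - n2 * (norm v)\<^sup>2 + \<gamma> * (norm v * norm p)"
    proof -
      have "c * (p \<bullet> \<phi> - p \<bullet> (Nch *v p)) \<le> c * (0 - \<nu> * (norm p)\<^sup>2)"
        using \<phi> c \<nu>(2)[of p] by (intro mult_left_mono) auto
      moreover have "\<bar>v \<bullet> (B *v p)\<bar> \<le> \<gamma> * (norm v * norm p)"
        unfolding \<gamma>_def by (rule inner_matrix_bound) auto
      ultimately show ?thesis using n1(2)[of z] n2(2)[of v] by linarith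
    qed
    also have "\<gamma> * (norm v * norm p) \<le> n2 / 2 * (norm v)\<^sup>2 + \<gamma>\<^sup>2 / (2 * n2) * (norm p)\<^sup>2"
    proof -
      have "0 \<le> (n2 * norm v - \<gamma> * norm p)\<^sup>2 / (2 * n2)" using n2 by simp
      then show ?thesis using n2 by (simp add: power2_eq_square field_simps)
    qed
    also have "c * (0 - \<nu> * (norm p)\<^sup>2) = - (\<gamma>\<^sup>2 / (2 * n2) + 1) * (norm p)\<^sup>2"
    proof -
      have "c * \<nu> = \<gamma>\<^sup>2 / (2 * n2) + 1" using \<nu> by (simp add: c_def)
      from this[symmetric] show ?thesis by simp
    qed
    finally have "c * (p \<bullet> (Jch *v p') + s \<bullet> (Mchi *v s')) +
        (z \<bullet> (Jpr *v z') + v \<bullet> v' + a \<bullet> (Mai *v a') + b \<bullet> (Mbi *v b')) \<le>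
        - (norm p)\<^sup>2 - n1 * (norm z)\<^sup>2 - n2 / 2 * (norm v)\<^sup>2"
      by (simp add: algebra_simps)
    also have "\<dots> \<le> - (k * (norm p)\<^sup>2) - k * (norm z)\<^sup>2 - k * (norm v)\<^sup>2"
      using mult_right_mono[OF k_le(1), of "(norm p)\<^sup>2"] mult_right_mono[OF k_le(2), of "(norm z)\<^sup>2"]
        mult_right_mono[OF k_le(3), of "(norm v)\<^sup>2"] by simp
    finally show "c * (p \<bullet> (Jch *v p') + s \<bullet> (Mchi *v s')) +
        (z \<bullet> (Jpr *v z') + v \<bullet> v' + a \<bullet> (Mai *v a') + b \<bullet> (Mbi *v b')) \<le>
        - k * ((norm p)\<^sup>2 + (norm z)\<^sup>2 + (norm v)\<^sup>2)" by (simp add: algebra_simps)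
  qed
qed

text \<open>Each product exposes one undamped variable: \<open>s \<bullet> (Jch *v p')\<close>
  contains the square of \<open>s\<close>, \<open>a \<bullet> v'\<close> that of \<open>a\<close>,
  and \<open>z' \<bullet> (Jpr *v (D0 *v b))\<close> contains
  \<open>(D *v b) \<bullet> (D0 *v b)\<close>. All other terms have a factor from \<open>p\<close>,
  \<open>z\<close> or \<open>v\<close>. The constant \<open>D0\<close> keeps the Lyapunov function
  quadratic while \<open>D\<close> varies with the state.\<close>

lemma cross_term_derivative:
  fixes Jch Mch Nch :: "real ^ 'ch ^ 'ch" and Jpr Npr Nsh Ma Mb D0 :: "real ^ 'pr ^ 'pr"
    and B :: "real ^ 'ch ^ 'pr" and L \<Omega> \<omega> :: real
  assumes Jpr: "symmetric_matrix Jpr" and \<omega>: "0 < \<omega>" and \<Omega>: "0 \<le> \<Omega>" and L: "0 \<le> L"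
  obtains C m where "0 \<le> C" "0 < m"
    "\<And>p s z v a b p' s' z' v' a' b' \<phi> D u w.
      Jch *v p' = \<phi> - Nch *v p + s \<Longrightarrow> s' = - (Mch *v p) \<Longrightarrow>
      Jpr *v z' = D *v b - v - Npr *v z \<Longrightarrow> v' = z + a - Nsh *v v - B *v p \<Longrightarrow>
      a' = - (Ma *v v) \<Longrightarrow> b' = - (Mb *v (D *v z)) \<Longrightarrow>
      norm \<phi> \<le> L * norm p \<Longrightarrow> norm (D *v z) \<le> \<Omega> * norm z \<Longrightarrow>
      \<omega> * (norm b)\<^sup>2 \<le> (D *v b) \<bullet> (D0 *v b) \<Longrightarrow>
      u = sqrt ((norm p)\<^sup>2 + (norm z)\<^sup>2 + (norm v)\<^sup>2) \<Longrightarrow>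
      w = sqrt ((norm s)\<^sup>2 + (norm a)\<^sup>2 + (norm b)\<^sup>2) \<Longrightarrow>
      m * w\<^sup>2 - C * (u * w) - C * u\<^sup>2 \<le>
        (s \<bullet> (Jch *v p') + s' \<bullet> (Jch *v p)) + (a \<bullet> v' + a' \<bullet> v)
        + (z \<bullet> (Jpr *v (D0 *v b')) + z' \<bullet> (Jpr *v (D0 *v b)))"
proof -
  define \<mu>ch where "\<mu>ch = (\<lambda>A :: real ^ 'ch ^ 'ch. onorm ((*v) A))"
  define \<mu>pr where "\<mu>pr = (\<lambda>A :: real ^ 'pr ^ 'pr. onorm ((*v) A))"
  define \<gamma> where "\<gamma> = onorm ((*v) B)"
  have nn: "0 \<le> \<mu>ch A" "0 \<le> \<mu>pr A'" "0 \<le> \<gamma>" for A A'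
    by (auto simp: \<mu>ch_def \<mu>pr_def \<gamma>_def intro!: onorm_pos_le)
  \<comment> \<open>\<open>C1\<close> collects the coefficients of the \<open>u * w\<close> terms,
    \<open>C2\<close> those of the \<open>u\<^sup>2\<close> terms.\<close>
  define C1 where "C1 = L + \<mu>ch Nch + 1 + \<mu>pr Nsh + \<gamma> + \<mu>pr D0 + \<mu>pr Npr * \<mu>pr D0"
  define C2 where "C2 = \<mu>ch Mch * \<mu>ch Jch + \<mu>pr Ma + \<mu>pr Jpr * (\<mu>pr D0 * (\<mu>pr Mb * \<Omega>))"
  define m where "m = min 1 \<omega>"
  have C0: "0 \<le> C1" "0 \<le> C2" using nn \<Omega> L by (auto simp: C1_def C2_def)
  have m: "0 < m" using \<omega> by (simp add: m_def)
  show ?thesis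
  proof (rule that[of "max C1 C2" m])
    show "0 \<le> max C1 C2" using C0 by simp
    fix p s z v a b p' s' z' v' a' b' \<phi> u w and D :: "real ^ 'pr ^ 'pr"
    assume eqs: "Jch *v p' = \<phi> - Nch *v p + s" "s' = - (Mch *v p)"
      "Jpr *v z' = D *v b - v - Npr *v z" "v' = z + a - Nsh *v v - B *v p"
      "a' = - (Ma *v v)" "b' = - (Mb *v (D *v z))"
      and \<phi>: "norm \<phi> \<le> L * norm p" and D: "norm (D *v z) \<le> \<Omega> * norm z"
      and Db: "\<omega> * (norm b)\<^sup>2 \<le> (D *v b) \<bullet> (D0 *v b)"
      and u: "u = sqrt ((norm p)\<^sup>2 + (norm z)\<^sup>2 + (norm v)\<^sup>2)"
      and w: "w = sqrt ((norm s)\<^sup>2 + (norm a)\<^sup>2 + (norm b)\<^sup>2)"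
    have le_u: "norm p \<le> u" "norm z \<le> u" "norm v \<le> u" unfolding u by (auto intro!: real_le_rsqrt)
    have le_w: "norm s \<le> w" "norm a \<le> w" "norm b \<le> w" unfolding w by (auto intro!: real_le_rsqrt)
    have uw: "0 \<le> u" "0 \<le> w" by (auto simp: u w)
    have b0: "norm (D0 *v b) \<le> \<mu>pr D0 * w"
      using norm_matrix_vector_mult_bound[OF le_w(3)] by (simp add: \<mu>pr_def)
    have Dz: "norm (D *v z) \<le> \<Omega> * u" using D le_u \<Omega> by (meson mult_left_mono order_trans)
    have bounds_uw: "\<bar>s \<bullet> \<phi>\<bar> \<le> L * (u * w)" "\<bar>s \<bullet> (Nch *v p)\<bar> \<le> \<mu>ch Nch * (u * w)"
      "\<bar>a \<bullet> z\<bar> \<le> u * w" "\<bar>a \<bullet> (Nsh *v v)\<bar> \<le> \<mu>pr Nsh * (u * w)"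
      "\<bar>a \<bullet> (B *v p)\<bar> \<le> \<gamma> * (u * w)" "\<bar>v \<bullet> (D0 *v b)\<bar> \<le> \<mu>pr D0 * (u * w)"
      "\<bar>(Npr *v z) \<bullet> (D0 *v b)\<bar> \<le> \<mu>pr Npr * \<mu>pr D0 * (u * w)"
    proof -
      have "\<bar>s \<bullet> \<phi>\<bar> \<le> norm s * norm \<phi>" by (rule Cauchy_Schwarz_ineq2)
      also have "\<dots> \<le> w * (L * u)"
        using \<phi> le_u(1) le_w(1) L uw by (intro mult_mono) (auto intro: order_trans mult_left_mono)
      finally show "\<bar>s \<bullet> \<phi>\<bar> \<le> L * (u * w)" by (simp add: mult_ac)
      have "\<bar>a \<bullet> z\<bar> \<le> norm a * norm z" by (rule Cauchy_Schwarz_ineq2)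
      also have "\<dots> \<le> w * u" using le_u le_w uw by (intro mult_mono) auto
      finally show "\<bar>a \<bullet> z\<bar> \<le> u * w" by (simp add: mult_ac)
      show "\<bar>s \<bullet> (Nch *v p)\<bar> \<le> \<mu>ch Nch * (u * w)" "\<bar>a \<bullet> (Nsh *v v)\<bar> \<le> \<mu>pr Nsh * (u * w)"
        "\<bar>a \<bullet> (B *v p)\<bar> \<le> \<gamma> * (u * w)"
        using inner_matrix_bound[OF le_w(1) le_u(1), of Nch] inner_matrix_bound[OF le_w(2) le_u(3), of Nsh]
          inner_matrix_bound[OF le_w(2) le_u(1), of B]
        by (auto simp: \<mu>ch_def \<mu>pr_def \<gamma>_def mult.commute[of w u])
      show "\<bar>v \<bullet> (D0 *v b)\<bar> \<le> \<mu>pr D0 * (u * w)"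
        using inner_matrix_bound[OF le_u(3) le_w(3), of D0] by (simp add: \<mu>pr_def)
      show "\<bar>(Npr *v z) \<bullet> (D0 *v b)\<bar> \<le> \<mu>pr Npr * \<mu>pr D0 * (u * w)"
        using inner_matrix_bound[OF b0 le_u(2), of Npr] by (simp add: \<mu>pr_def inner_commute mult_ac)
    qed
    have bounds_uu: "\<bar>(Mch *v p) \<bullet> (Jch *v p)\<bar> \<le> \<mu>ch Mch * \<mu>ch Jch * u\<^sup>2"
      "\<bar>(Ma *v v) \<bullet> v\<bar> \<le> \<mu>pr Ma * u\<^sup>2"
      "\<bar>z \<bullet> (Jpr *v (D0 *v (Mb *v (D *v z))))\<bar> \<le> \<mu>pr Jpr * (\<mu>pr D0 * (\<mu>pr Mb * \<Omega>)) * u\<^sup>2"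
    proof -
      show "\<bar>(Mch *v p) \<bullet> (Jch *v p)\<bar> \<le> \<mu>ch Mch * \<mu>ch Jch * u\<^sup>2"
        using inner_matrix_bound[OF norm_matrix_vector_mult_bound[OF le_u(1), of Mch] le_u(1), of Jch]
        by (simp add: \<mu>ch_def mult_ac power2_eq_square)
      show "\<bar>(Ma *v v) \<bullet> v\<bar> \<le> \<mu>pr Ma * u\<^sup>2"
        using inner_matrix_bound[OF le_u(3) le_u(3), of Ma]
        by (simp add: \<mu>pr_def inner_commute power2_eq_square)
      have "norm (D0 *v (Mb *v (D *v z))) \<le> \<mu>pr D0 * (\<mu>pr Mb * (\<Omega> * u))"
        unfolding \<mu>pr_def by (intro norm_matrix_vector_mult_bound Dz)
      from inner_matrix_bound[OF le_u(2) this, of Jpr]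
      show "\<bar>z \<bullet> (Jpr *v (D0 *v (Mb *v (D *v z))))\<bar> \<le> \<mu>pr Jpr * (\<mu>pr D0 * (\<mu>pr Mb * \<Omega>)) * u\<^sup>2"
        by (simp add: \<mu>pr_def mult_ac power2_eq_square)
    qed
    \<comment> \<open>Moving the symmetric \<open>Jpr\<close> onto \<open>z'\<close> makes the
      equation of motion applicable without inverting \<open>Jpr\<close>.\<close>
    have z'J: "z' \<bullet> (Jpr *v (D0 *v b)) = (D *v b - v - Npr *v z) \<bullet> (D0 *v b)"
      using inner_symmetric_matrix[OF Jpr, of z'] eqs(3) by simp
    have "(s \<bullet> (Jch *v p') + s' \<bullet> (Jch *v p)) + (a \<bullet> v' + a' \<bullet> v)
        + (z \<bullet> (Jpr *v (D0 *v b')) + z' \<bullet> (Jpr *v (D0 *v b))) =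
        (norm s)\<^sup>2 + (norm a)\<^sup>2 + (D *v b) \<bullet> (D0 *v b)
        + (s \<bullet> \<phi> - s \<bullet> (Nch *v p) + a \<bullet> z - a \<bullet> (Nsh *v v) - a \<bullet> (B *v p) - v \<bullet> (D0 *v b)
          - (Npr *v z) \<bullet> (D0 *v b))
        - ((Mch *v p) \<bullet> (Jch *v p) + (Ma *v v) \<bullet> v + z \<bullet> (Jpr *v (D0 *v (Mb *v (D *v z)))))"
      unfolding z'J unfolding eqs power2_norm_eq_inner
      by (simp add: matrix_vector_mult_minus inner_add_right inner_diff_right inner_diff_left)
    also have "\<dots> \<ge> (norm s)\<^sup>2 + (norm a)\<^sup>2 + \<omega> * (norm b)\<^sup>2 - C1 * (u * w) - C2 * u\<^sup>2"
      using bounds_uw(1,3)[THEN abs_le_D2] bounds_uw(2,4-7)[THEN abs_le_D1]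
        bounds_uu[THEN abs_le_D1] Db
      unfolding C1_def C2_def distrib_right by linarith
    moreover have "m * w\<^sup>2 \<le> (norm s)\<^sup>2 + (norm a)\<^sup>2 + \<omega> * (norm b)\<^sup>2"
      using mult_right_mono[of m 1 "(norm s)\<^sup>2"] mult_right_mono[of m 1 "(norm a)\<^sup>2"]
        mult_right_mono[of m \<omega> "(norm b)\<^sup>2"] by (simp add: w m_def distrib_left)
    moreover have "C1 * (u * w) \<le> max C1 C2 * (u * w)" "C2 * u\<^sup>2 \<le> max C1 C2 * u\<^sup>2"
      using uw by (auto intro!: mult_right_mono)
    ultimately show "m * w\<^sup>2 - max C1 C2 * (u * w) - max C1 C2 * u\<^sup>2 \<le>
        (s \<bullet> (Jch *v p') + s' \<bullet> (Jch *v p)) + (a \<bullet> v' + a' \<bullet> v)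
        + (z \<bullet> (Jpr *v (D0 *v b')) + z' \<bullet> (Jpr *v (D0 *v b)))" by linarith
  qed (rule m)
qed

section \<open>The Lyapunov function as a bilinear form\<close>

text \<open>The Lyapunov function is the diagonal of this form. The energy is halved and each cross
  product entered in one order only, so that adding both argument orders yields the energy rate and
  the product rule for the cross terms. The combination \<open>q - a + Nsh *v v\<close> is the
  deviation coordinate \<open>z\<close>.\<close>

definition lyapunov_form ::
  "real \<Rightarrow> real \<Rightarrow> real ^ 'ch ^ 'ch \<Rightarrow> real ^ 'ch ^ 'ch \<Rightarrow> real ^ 'pr ^ 'pr \<Rightarrow> real ^ 'pr ^ 'pr \<Rightarrow>
   real ^ 'pr ^ 'pr \<Rightarrow> real ^ 'pr ^ 'pr \<Rightarrow> real ^ 'pr ^ 'pr \<Rightarrow>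
   ('ch, 'pr) dh_state \<Rightarrow> ('ch, 'pr) dh_state \<Rightarrow> real" where
  "lyapunov_form c \<epsilon> Jch Mchi Jpr Nsh Mai Mbi D0 = (\<lambda>(p, s, q, v, a, b) (p', s', q', v', a', b').
     (c * (p \<bullet> (Jch *v p') + s \<bullet> (Mchi *v s'))
      + ((q - a + Nsh *v v) \<bullet> (Jpr *v (q' - a' + Nsh *v v')) + v \<bullet> v'
         + a \<bullet> (Mai *v a') + b \<bullet> (Mbi *v b'))) / 2
     - \<epsilon> * (s \<bullet> (Jch *v p') + a \<bullet> v' + (q - a + Nsh *v v) \<bullet> (Jpr *v (D0 *v b'))))"

lemma bounded_bilinear_lyapunov_form:
  "bounded_bilinear (lyapunov_form c \<epsilon> Jch Mchi Jpr Nsh Mai Mbi D0)"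
  unfolding bilinear_conv_bounded_bilinear[symmetric] bilinear_def lyapunov_form_def case_prod_beta
  by (intro conjI allI linearI)
    (simp_all add: inner_add_left inner_add_right inner_diff_left inner_diff_right
      matrix_vector_right_distrib matrix_vector_mult_diff_distrib matrix_vector_mult_scaleR
      field_simps)

text \<open>With velocities as primed arguments this is the time derivative of the Lyapunov
  function, arranged into the two expressions estimated by \<open>energy_dissipation\<close> and
  \<open>cross_term_derivative\<close>.\<close>

lemma lyapunov_form_symmetrized:
  assumes "symmetric_matrix Jch" "symmetric_matrix Mchi" "symmetric_matrix Jpr"
    "symmetric_matrix Mai" "symmetric_matrix Mbi"
    and z: "z = q - a + Nsh *v v" "z' = q' - a' + Nsh *v v'"
  shows "lyapunov_form c \<epsilon> Jch Mchi Jpr Nsh Mai Mbi D0 (p, s, q, v, a, b) (p', s', q', v', a', b') +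
      lyapunov_form c \<epsilon> Jch Mchi Jpr Nsh Mai Mbi D0 (p', s', q', v', a', b') (p, s, q, v, a, b) =
      c * (p \<bullet> (Jch *v p') + s \<bullet> (Mchi *v s')) +
        (z \<bullet> (Jpr *v z') + v \<bullet> v' + a \<bullet> (Mai *v a') + b \<bullet> (Mbi *v b'))
      - \<epsilon> * ((s \<bullet> (Jch *v p') + s' \<bullet> (Jch *v p)) + (a \<bullet> v' + a' \<bullet> v)
        + (z \<bullet> (Jpr *v (D0 *v b')) + z' \<bullet> (Jpr *v (D0 *v b))))"
proof -
  have sym: "x' \<bullet> (A *v x) = x \<bullet> (A *v x')" if "symmetric_matrix A" for A :: "real ^ 'n ^ 'n" and x x'
    using inner_symmetric_matrix[OF that] by (metis inner_commute)
  show ?thesis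
    unfolding lyapunov_form_def prod.case z(1)[symmetric] z(2)[symmetric]
      sym[OF assms(1), of p' p] sym[OF assms(2), of s' s] sym[OF assms(3), of z' z]
      sym[OF assms(4), of a' a] sym[OF assms(5), of b' b] inner_commute[of v' v]
    by (simp add: field_simps)
qed

text \<open>The cross terms are bounded by a multiple of the same sum of squares that the energy
  dominates, so a small \<epsilon> cannot destroy positivity.\<close>

lemma lyapunov_form_coercive:
  fixes Jch Mchi :: "real ^ 'ch ^ 'ch" and Jpr Nsh Mai Mbi D0 :: "real ^ 'pr ^ 'pr"
  assumes "positive_definite Jch" "positive_definite Mchi" "positive_definite Jpr"
    "positive_definite Mai" "positive_definite Mbi" and c: "0 < c"
  obtains \<mu> C where "0 < \<mu>" "0 \<le> C"
    "\<And>\<epsilon> p s q v a b z. 0 \<le> \<epsilon> \<Longrightarrow> \<epsilon> * C \<le> \<mu> \<Longrightarrow> z = q - a + Nsh *v v \<Longrightarrow>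
      \<mu> * ((norm p)\<^sup>2 + (norm s)\<^sup>2 + (norm z)\<^sup>2 + (norm v)\<^sup>2 + (norm a)\<^sup>2 + (norm b)\<^sup>2) \<le>
      lyapunov_form c \<epsilon> Jch Mchi Jpr Nsh Mai Mbi D0 (p, s, q, v, a, b) (p, s, q, v, a, b)"
proof -
  obtain m1 where m1: "0 < m1" "\<And>x. m1 * (norm x)\<^sup>2 \<le> x \<bullet> (Jch *v x)"
    using positive_definite_coercive[OF assms(1)] by blast
  obtain m2 where m2: "0 < m2" "\<And>x. m2 * (norm x)\<^sup>2 \<le> x \<bullet> (Mchi *v x)"
    using positive_definite_coercive[OF assms(2)] by blast
  obtain m3 where m3: "0 < m3" "\<And>x. m3 * (norm x)\<^sup>2 \<le> x \<bullet> (Jpr *v x)"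
    using positive_definite_coercive[OF assms(3)] by blast
  obtain m4 where m4: "0 < m4" "\<And>x. m4 * (norm x)\<^sup>2 \<le> x \<bullet> (Mai *v x)"
    using positive_definite_coercive[OF assms(4)] by blast
  obtain m5 where m5: "0 < m5" "\<And>x. m5 * (norm x)\<^sup>2 \<le> x \<bullet> (Mbi *v x)"
    using positive_definite_coercive[OF assms(5)] by blast
  \<comment> \<open>The 4 is a budget: half the energy provides \<open>2 * \<mu>\<close> times the
    sum of squares, and the cross terms consume at most one \<mu>.\<close>
  define \<mu> where "\<mu> = Min {c * m1, c * m2, m3, 1, m4, m5} / 4"
  define C where "C = onorm ((*v) Jch) + 1 + onorm ((*v) (Jpr ** D0))"
  have \<mu>: "0 < \<mu>" using c m1 m2 m3 m4 m5 by (simp add: \<mu>_def)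
  have \<mu>_le: "4 * \<mu> \<le> c * m1" "4 * \<mu> \<le> c * m2" "4 * \<mu> \<le> m3" "4 * \<mu> \<le> 1" "4 * \<mu> \<le> m4" "4 * \<mu> \<le> m5"
    by (auto simp: \<mu>_def)
  have nn: "0 \<le> onorm ((*v) Jch)" "0 \<le> onorm ((*v) (Jpr ** D0))" by (auto intro!: onorm_pos_le)
  show ?thesis
  proof (rule that[OF \<mu>])
    show "0 \<le> C" using nn by (simp add: C_def)
    fix \<epsilon> :: real and p s :: "real ^ 'ch" and q v a b z :: "real ^ 'pr"
    assume \<epsilon>: "0 \<le> \<epsilon>" "\<epsilon> * C \<le> \<mu>" and z: "z = q - a + Nsh *v v"
    define E where "E = (norm p)\<^sup>2 + (norm s)\<^sup>2 + (norm z)\<^sup>2 + (norm v)\<^sup>2 + (norm a)\<^sup>2 + (norm b)\<^sup>2"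
    define X where "X = s \<bullet> (Jch *v p) + a \<bullet> v + z \<bullet> (Jpr *v (D0 *v b))"
    have E0: "0 \<le> E" by (simp add: E_def)
    have prod_le: "x * y \<le> E" if "x\<^sup>2 + y\<^sup>2 \<le> E" for x y :: real
    proof -
      have "2 * (x * y) \<le> x\<^sup>2 + y\<^sup>2" using sum_squares_bound[of x y] by simp
      then show ?thesis using that E0 by linarith
    qed
    have X: "X \<le> C * E"
    proof -
      have "s \<bullet> (Jch *v p) \<le> onorm ((*v) Jch) * (norm s * norm p)"
        by (rule abs_le_D1[OF inner_matrix_bound]) auto
      also have "\<dots> \<le> onorm ((*v) Jch) * E" by (intro mult_left_mono prod_le nn) (simp add: E_def)
      finally have 1: "s \<bullet> (Jch *v p) \<le> onorm ((*v) Jch) * E" .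
      have "z \<bullet> (Jpr *v (D0 *v b)) \<le> onorm ((*v) (Jpr ** D0)) * (norm z * norm b)"
        unfolding matrix_vector_mul_assoc by (rule abs_le_D1[OF inner_matrix_bound]) auto
      also have "\<dots> \<le> onorm ((*v) (Jpr ** D0)) * E" by (intro mult_left_mono prod_le nn) (simp add: E_def)
      finally have 2: "z \<bullet> (Jpr *v (D0 *v b)) \<le> onorm ((*v) (Jpr ** D0)) * E" .
      have "a \<bullet> v \<le> norm a * norm v" by (rule norm_cauchy_schwarz)
      also have "\<dots> \<le> E" by (rule prod_le) (simp add: E_def)
      finally have "a \<bullet> v \<le> E" .
      with 1 2 show ?thesis by (simp add: X_def C_def algebra_simps)
    qed
    have "\<epsilon> * X \<le> \<epsilon> * (C * E)" using X \<epsilon> by (intro mult_left_mono)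
    also have "\<dots> \<le> \<mu> * E" using mult_right_mono[OF \<epsilon>(2) E0] by (simp add: mult_ac)
    finally have cross: "\<epsilon> * X \<le> \<mu> * E" .
    have scaled: "4 * \<mu> * x\<^sup>2 \<le> c * y" if "4 * \<mu> \<le> c * m" "m * x\<^sup>2 \<le> y" for m x y :: real
      using mult_right_mono[OF that(1) zero_le_power2[of x]] mult_left_mono[OF that(2), of c] c
      by (simp only: mult.assoc) linarith
    have "4 * \<mu> * (norm p)\<^sup>2 \<le> c * (p \<bullet> (Jch *v p))"
      by (rule scaled[OF \<mu>_le(1) m1(2)])
    moreover have "4 * \<mu> * (norm s)\<^sup>2 \<le> c * (s \<bullet> (Mchi *v s))"
      by (rule scaled[OF \<mu>_le(2) m2(2)])
    moreover have "4 * \<mu> * (norm z)\<^sup>2 \<le> z \<bullet> (Jpr *v z)"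
      using mult_right_mono[OF \<mu>_le(3), of "(norm z)\<^sup>2"] m3(2)[of z] by simp
    moreover have "4 * \<mu> * (norm v)\<^sup>2 \<le> v \<bullet> v"
      using mult_right_mono[OF \<mu>_le(4), of "(norm v)\<^sup>2"] by (simp add: power2_norm_eq_inner)
    moreover have "4 * \<mu> * (norm a)\<^sup>2 \<le> a \<bullet> (Mai *v a)"
      using mult_right_mono[OF \<mu>_le(5), of "(norm a)\<^sup>2"] m4(2)[of a] by simp
    moreover have "4 * \<mu> * (norm b)\<^sup>2 \<le> b \<bullet> (Mbi *v b)"
      using mult_right_mono[OF \<mu>_le(6), of "(norm b)\<^sup>2"] m5(2)[of b] by simp
    moreover define Q where "Q = c * (p \<bullet> (Jch *v p) + s \<bullet> (Mchi *v s))
        + (z \<bullet> (Jpr *v z) + v \<bullet> v + a \<bullet> (Mai *v a) + b \<bullet> (Mbi *v b))"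
    ultimately have "4 * \<mu> * E \<le> Q"
      unfolding E_def distrib_left by linarith
    then have "\<mu> * E \<le> Q / 2 - \<epsilon> * X" using cross \<mu> E0 by linarith
    then have "\<mu> * E \<le> lyapunov_form c \<epsilon> Jch Mchi Jpr Nsh Mai Mbi D0 (p, s, q, v, a, b) (p, s, q, v, a, b)"
      unfolding lyapunov_form_def prod.case z[symmetric] X_def[symmetric] Q_def .
    then show "\<mu> * ((norm p)\<^sup>2 + (norm s)\<^sup>2 + (norm z)\<^sup>2 + (norm v)\<^sup>2 + (norm a)\<^sup>2 + (norm b)\<^sup>2) \<le>
      lyapunov_form c \<epsilon> Jch Mchi Jpr Nsh Mai Mbi D0 (p, s, q, v, a, b) (p, s, q, v, a, b)"
      by (simp add: E_def)
  qed
qed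

text \<open>The estimates are in terms of \<open>z\<close>, stability is in terms of the state norm;
  \<open>q = z + a - Nsh *v v\<close> converts between them.\<close>

lemma norm_dh_state_le:
  fixes Nsh :: "real ^ 'pr ^ 'pr"
  obtains K where "0 < K"
    "\<And>(p :: real ^ 'ch) (s :: real ^ 'ch) q v a (b :: real ^ 'pr) z. z = q - a + Nsh *v v \<Longrightarrow>
      (norm (p, s, q, v, a, b))\<^sup>2 \<le>
      K * ((norm p)\<^sup>2 + (norm s)\<^sup>2 + (norm z)\<^sup>2 + (norm v)\<^sup>2 + (norm a)\<^sup>2 + (norm b)\<^sup>2)"
proof -
  define n where "n = onorm ((*v) Nsh)"
  \<comment> \<open>Squaring the three summands of \<open>q\<close> gives the coefficients 3 for
    \<open>z\<close>, 3 + 1 for \<open>a\<close> and \<open>3 * n\<^sup>2 + 1\<close> for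
    \<open>v\<close>; \<open>K\<close> dominates all of them.\<close>
  define K where "K = 4 + 3 * n\<^sup>2"
  have K: "0 < K" by (simp add: K_def add_pos_nonneg)
  show ?thesis
  proof (rule that[OF K])
    fix p :: "real ^ 'ch" and s :: "real ^ 'ch" and q v a and b :: "real ^ 'pr" and z
    assume z: "z = q - a + Nsh *v v"
    have "norm q \<le> norm z + norm a + norm (Nsh *v v)"
    proof -
      have "q = (z + a) - Nsh *v v" by (simp add: z)
      then have "norm q \<le> norm (z + a) + norm (Nsh *v v)" by (metis norm_triangle_ineq4)
      then show ?thesis using norm_triangle_ineq[of z a] by linarith
    qed
    then have "norm q \<le> norm z + norm a + n * norm v"
      using norm_matrix_vector_mult_bound[of v "norm v" Nsh] by (simp add: n_def)
    then have "(norm q)\<^sup>2 \<le> (norm z + norm a + n * norm v)\<^sup>2" by (intro power_mono) auto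
    also have "\<dots> \<le> 3 * ((norm z)\<^sup>2 + (norm a)\<^sup>2 + n\<^sup>2 * (norm v)\<^sup>2)"
    proof -
      have "0 \<le> (norm z - norm a)\<^sup>2 + (norm z - n * norm v)\<^sup>2 + (norm a - n * norm v)\<^sup>2" by simp
      then show ?thesis by (simp add: power2_eq_square algebra_simps)
    qed
    finally have q: "(norm q)\<^sup>2 \<le> 3 * (norm z)\<^sup>2 + 3 * (norm a)\<^sup>2 + 3 * (n\<^sup>2 * (norm v)\<^sup>2)"
      by (simp only: distrib_left)
    have K1: "x \<le> K * x" if "0 \<le> x" for x
      using mult_right_mono[of 1 K x] that by (simp add: K_def)
    have "(norm (p, s, q, v, a, b))\<^sup>2 =
        (norm p)\<^sup>2 + (norm s)\<^sup>2 + (norm q)\<^sup>2 + (norm v)\<^sup>2 + (norm a)\<^sup>2 + (norm b)\<^sup>2"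
      by (simp add: norm_Pair)
    also have "\<dots> \<le> K * (norm p)\<^sup>2 + K * (norm s)\<^sup>2 + K * (norm z)\<^sup>2 + K * (norm v)\<^sup>2 + K * (norm a)\<^sup>2
        + K * (norm b)\<^sup>2"
    proof -
      have "0 \<le> n\<^sup>2 * (norm z)\<^sup>2" "0 \<le> n\<^sup>2 * (norm a)\<^sup>2" by simp_all
      moreover have "K * (norm z)\<^sup>2 = 4 * (norm z)\<^sup>2 + 3 * (n\<^sup>2 * (norm z)\<^sup>2)"
        "K * (norm a)\<^sup>2 = 4 * (norm a)\<^sup>2 + 3 * (n\<^sup>2 * (norm a)\<^sup>2)"
        "K * (norm v)\<^sup>2 = 4 * (norm v)\<^sup>2 + 3 * (n\<^sup>2 * (norm v)\<^sup>2)"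
        by (simp_all add: K_def algebra_simps)
      moreover have "0 \<le> (norm z)\<^sup>2" "0 \<le> (norm a)\<^sup>2" "0 \<le> (norm v)\<^sup>2" by simp_all
      ultimately show ?thesis
        using q K1[of "(norm p)\<^sup>2", OF zero_le_power2] K1[of "(norm s)\<^sup>2", OF zero_le_power2]
          K1[of "(norm b)\<^sup>2", OF zero_le_power2] by linarith
    qed
    finally show "(norm (p, s, q, v, a, b))\<^sup>2 \<le>
      K * ((norm p)\<^sup>2 + (norm s)\<^sup>2 + (norm z)\<^sup>2 + (norm v)\<^sup>2 + (norm a)\<^sup>2 + (norm b)\<^sup>2)"
      by (simp add: algebra_simps)
  qed
qed

section \<open>The closed loop\<close>

text \<open>\<open>Jchi\<close> and \<open>Jpri\<close> stand for the inverses of \<open>Jch\<close> and \<open>Jpr\<close>.\<close>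

definition closed_loop_field ::
  "real ^ 'ch ^ 'ch \<Rightarrow> real ^ 'pr ^ 'pr \<Rightarrow> real ^ 'pr ^ 'pr \<Rightarrow> (real ^ 'ch \<Rightarrow> real ^ 'ch) \<Rightarrow> real ^ 'pr \<Rightarrow>
   real ^ 'ch ^ 'pr \<Rightarrow> real ^ 'ch ^ 'ch \<Rightarrow> real ^ 'ch ^ 'ch \<Rightarrow>
   real ^ 'pr ^ 'pr \<Rightarrow> real ^ 'pr ^ 'pr \<Rightarrow> real ^ 'pr ^ 'pr \<Rightarrow> real ^ 'pr ^ 'pr \<Rightarrow>
   real ^ 'ch \<Rightarrow> real ^ 'pr \<Rightarrow> ('ch, 'pr) dh_state \<Rightarrow> ('ch, 'pr) dh_state" where
  "closed_loop_field Jchi Jpri Jpr fch \<theta> B Mch Nch Npr Nsh Ma Mb qref Vref =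
     (\<lambda>(qch, xch, qpr, Vsh, xa, xb).
       (Jchi *v (fch qch + u_ch Nch qref qch xch),
        - (Mch *v (qch - qref)),
        Jpri *v (- (W qpr *v \<theta>) + u_pr Jpr B Npr Nsh Ma Vref qch qpr Vsh xa xb),
        qpr - B *v qch,
        - (Ma *v (Vsh - Vref)),
        - (Mb *v (W qpr *v z_pr Nsh Vref qpr Vsh xa))))"

lemma closed_loop_iff_field:
  assumes "\<And>x. Jchi *v (Jch *v x) = x" "\<And>x. Jch *v (Jchi *v x) = x"
    and "\<And>x. Jpri *v (Jpr *v x) = x" "\<And>x. Jpr *v (Jpri *v x) = x"
  shows "closed_loop Jch Jpr fch \<theta> B Mch Nch Npr Nsh Ma Mb qref Vref x v \<longleftrightarrow>
    v = closed_loop_field Jchi Jpri Jpr fch \<theta> B Mch Nch Npr Nsh Ma Mb qref Vref x"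
proof -
  obtain qch xch qpr Vsh xa xb where x: "x = (qch, xch, qpr, Vsh, xa, xb)" by (metis prod.exhaust)
  obtain qch' xch' qpr' Vsh' xa' xb' where v: "v = (qch', xch', qpr', Vsh', xa', xb')"
    by (metis prod.exhaust)
  have "Jch *v y = r \<longleftrightarrow> y = Jchi *v r" "Jpr *v y' = r' \<longleftrightarrow> y' = Jpri *v r'" for y r y' r'
    using assms by metis+
  then show ?thesis unfolding x v closed_loop.simps closed_loop_field_def prod.case prod.inject by blast
qed

lemma lipschitzian_on_closed_loop_field:
  assumes f: "continuously_differentiable fch" and X: "bounded X"
  shows "lipschitzian_on X (closed_loop_field Jchi Jpri Jpr fch \<theta> B Mch Nch Npr Nsh Ma Mb qref Vref)"
proof -
  have "lipschitzian_on X (\<lambda>x. fch (fst x))"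
    by (rule lipschitzian_on_compose[of fst X fch])
      (intro continuously_differentiable_lipschitzian_on[OF f] bounded_fst X lipschitzian_intros)+
  then show ?thesis
    unfolding closed_loop_field_def case_prod_beta u_ch_def u_pr_def z_pr_def
    by (intro lipschitzian_intros lipschitzian_on_W_mult X)
qed

section \<open>The equilibrium and the dynamics of deviations from it\<close>

text \<open>The integrators of \<open>xch\<close> and \<open>xa\<close> force the setpoints, and the
  volume balance then gives \<open>qpr\<close>. Nonzero flows make \<open>W qpr\<close> injective,
  which is used twice: for \<open>z_pr = 0\<close>, hence \<open>xa = qpr\<close>, and for
  \<open>xb = \<theta>\<close>.\<close>

lemma closed_loop_equilibrium:
  assumes eq: "equilibrium (closed_loop Jch Jpr fch \<theta> B Mch Nch Npr Nsh Ma Mb qref Vref)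
      (qch, xch, qpr, Vsh, xa, xb)"
    and pd: "positive_definite Mch" "positive_definite Ma" "positive_definite Mb"
    and q: "\<forall>i. qpr $ i \<noteq> 0"
  shows "qch = qref" "xch = - fch qref" "qpr = B *v qref" "Vsh = Vref" "xa = qpr" "xb = \<theta>"
proof -
  have ker: "x = 0" if "positive_definite A" "A *v x = 0" for A :: "real ^ 'n ^ 'n" and x
    using that unfolding positive_definite_def by (metis inner_zero_right less_irrefl)
  have W0: "x = 0" if "W qpr *v x = 0" for x
    using that q by (simp add: W_mult vec_eq_iff)
  note eqs = eq[unfolded equilibrium_def zero_prod_def closed_loop.simps]
  show qch: "qch = qref" using eqs ker[OF pd(1), of "qch - qref"] by simp
  show V: "Vsh = Vref" using eqs ker[OF pd(2), of "Vsh - Vref"] by simp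
  show "xch = - fch qref" using eqs qch by (simp add: u_ch_def add_eq_0_iff)
  show qpr: "qpr = B *v qref" using eqs qch by simp
  have "0 = - (Mb *v (W qpr *v z_pr Nsh Vref qpr Vsh xa))" using eqs by (elim conjE)
  then have "Mb *v (W qpr *v z_pr Nsh Vref qpr Vsh xa) = 0" by simp
  then have "z_pr Nsh Vref qpr Vsh xa = 0" using W0 ker[OF pd(3)] by metis
  then show xa: "xa = qpr" using V by (simp add: z_pr_def)
  have "W qpr *v (xb - \<theta>) = 0"
  proof -
    have "Jpr *v 0 = - (W qpr *v \<theta>) + u_pr Jpr B Npr Nsh Ma Vref qch qpr Vsh xa xb"
      using eqs by (elim conjE)
    also have "\<dots> = - (W qpr *v \<theta>) + W qpr *v xb"
      by (simp add: u_pr_def z_pr_def V xa qch flip: qpr)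
    finally show ?thesis by (simp add: matrix_vector_mult_diff_distrib)
  qed
  then show "xb = \<theta>" using W0[of "xb - \<theta>"] by simp
qed

text \<open>The \<open>Jpr\<close> terms of \<open>u_pr\<close> compensate exactly for
  \<open>Jpr *v (Nsh *v v' - a')\<close>, and the \<theta> part of \<open>xb\<close> cancels the
  friction. What remains of the producer equation is \<open>b\<close> through \<open>W\<close>, the
  coupling \<open>- v\<close> and the damping by \<open>Npr\<close>.\<close>

lemma closed_loop_deviation:
  assumes "closed_loop Jch Jpr fch \<theta> B Mch Nch Npr Nsh Ma Mb qref Vref
      (qref + p, - fch qref + s, B *v qref + q, Vref + v, B *v qref + a, \<theta> + b)
      (p', s', q', v', a', b')"
    and z: "z = q - a + Nsh *v v" "z' = q' - a' + Nsh *v v'"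
  shows "Jch *v p' = (fch (qref + p) - fch qref) - Nch *v p + s" "s' = - (Mch *v p)"
    "Jpr *v z' = W (B *v qref + q) *v b - v - Npr *v z" "v' = z + a - Nsh *v v - B *v p"
    "a' = - (Ma *v v)" "b' = - (Mb *v (W (B *v qref + q) *v z))"
proof -
  note eqs = assms(1)[unfolded closed_loop.simps u_ch_def u_pr_def z_pr_def]
  show v': "v' = z + a - Nsh *v v - B *v p" using eqs by (simp add: z matrix_vector_right_distrib)
  show a': "a' = - (Ma *v v)" using eqs by simp
  show "Jch *v p' = (fch (qref + p) - fch qref) - Nch *v p + s" "s' = - (Mch *v p)"
    "b' = - (Mb *v (W (B *v qref + q) *v z))"
    using eqs by (simp_all add: z)
  have "Jpr *v q' = - (W (B *v qref + q) *v \<theta>) + (W (B *v qref + q) *v (\<theta> + b)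
      - (Jpr ** (Ma - Nsh ** Nsh) + mat 1) *v v - (Jpr ** Nsh + Npr) *v z
      + (Jpr ** Nsh) *v (B *v (qref + p) - (B *v qref + a)))"
    using eqs by (simp add: z)
  then show "Jpr *v z' = W (B *v qref + q) *v b - v - Npr *v z"
    unfolding z(2) v' a'
    by (simp add: z(1) matrix_vector_right_distrib matrix_vector_mult_diff_distrib
        matrix_vector_mult_add_rdistrib matrix_vector_mult_diff_rdistrib matrix_vector_mult_minus
        matrix_vector_mul_assoc[symmetric])
qed

text \<open>Component \<open>i\<close> contributes \<open>\<bar>x\<bar> * x\<close> times the square
  of \<open>b $ i\<close>, where \<open>x = (q0 + q) $ i * q0 $ i\<close>. A perturbation of at most
  half the smallest flow preserves the signs, so \<open>x\<close> is at least
  \<open>h\<^sup>2 / 2\<close>.\<close>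

lemma W_product_coercive:
  fixes q0 :: "real ^ 'n"
  assumes q0: "\<forall>i. q0 $ i \<noteq> 0"
  obtains r \<omega> where "0 < r" "0 < \<omega>"
    "\<And>q b. norm q \<le> r \<Longrightarrow> \<omega> * (norm b)\<^sup>2 \<le> (W (q0 + q) *v b) \<bullet> (W q0 *v b)"
proof -
  define h where "h = Min (range (\<lambda>i. \<bar>q0 $ i\<bar>))"
  have h: "0 < h" using q0 by (simp add: h_def)
  have h_le: "h \<le> \<bar>q0 $ i\<bar>" for i by (simp add: h_def)
  show ?thesis
  proof (rule that[of "h / 2" "(h\<^sup>2 / 2)\<^sup>2"])
    fix q b :: "real ^ 'n" assume q: "norm q \<le> h / 2"
    have "(h\<^sup>2 / 2)\<^sup>2 * (b $ i * b $ i) \<le> (W (q0 + q) *v b) $ i * (W q0 *v b) $ i" for i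
    proof -
      define x where "x = (q0 + q) $ i * q0 $ i"
      have "\<bar>q $ i\<bar> \<le> \<bar>q0 $ i\<bar> / 2" using component_le_norm_cart[of q i] q h_le[of i] by linarith
      then have "\<bar>q $ i\<bar> * \<bar>q0 $ i\<bar> \<le> \<bar>q0 $ i\<bar> / 2 * \<bar>q0 $ i\<bar>" by (intro mult_right_mono) auto
      then have "\<bar>q $ i * q0 $ i\<bar> \<le> (q0 $ i)\<^sup>2 / 2" by (simp add: abs_mult power2_eq_square)
      then have "(q0 $ i)\<^sup>2 / 2 \<le> x" by (simp add: x_def algebra_simps power2_eq_square)
      moreover have "h\<^sup>2 \<le> \<bar>q0 $ i\<bar>\<^sup>2" using h h_le by (intro power_mono) auto
      ultimately have x: "h\<^sup>2 / 2 \<le> x" by simp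
      then have "0 \<le> x" using zero_le_power2[of h] by linarith
      moreover have "(h\<^sup>2 / 2)\<^sup>2 \<le> x\<^sup>2" using x by (intro power_mono) auto
      ultimately have "(h\<^sup>2 / 2)\<^sup>2 * (b $ i * b $ i) \<le> \<bar>x\<bar> * x * (b $ i * b $ i)"
        by (intro mult_right_mono) (auto simp: power2_eq_square)
      then show ?thesis by (simp add: W_mult x_def abs_mult mult_ac)
    qed
    then show "(h\<^sup>2 / 2)\<^sup>2 * (norm b)\<^sup>2 \<le> (W (q0 + q) *v b) \<bullet> (W q0 *v b)"
      unfolding power2_norm_eq_inner inner_vec_def sum_distrib_left inner_real_def
      by (intro sum_mono)
  qed (use h in auto)
qed

theorem theorem1:
  fixes Jch Mch Nch :: "real ^ 'ch ^ 'ch"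
    and Jpr Npr Nsh Ma Mb :: "real ^ 'pr ^ 'pr"
    and fch :: "real ^ 'ch \<Rightarrow> real ^ 'ch"
    and \<theta> :: "real ^ 'pr"
    and B :: "real ^ 'ch ^ 'pr"
    and qref :: "real ^ 'ch"
    and Vref :: "real ^ 'pr"
  defines "Sys \<equiv> closed_loop Jch Jpr fch \<theta> B Mch Nch Npr Nsh Ma Mb qref Vref"
  assumes "symmetric_matrix Jch" and "positive_definite Jch"
    and "diagonal_matrix Jpr" and "positive_definite Jpr"
    and "continuously_differentiable fch"
    and "monotone_operator (\<lambda>x. - fch x)"
    and "\<forall>i. 0 < \<theta> $ i"
    and "\<forall>i j. B $ i $ j \<in> {-1, 0, 1}"
    and "diagonal_matrix Mch" and "positive_definite Mch"
    and "diagonal_matrix Nch" and "positive_definite Nch"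
    and "diagonal_matrix Npr" and "positive_definite Npr"
    and "diagonal_matrix Nsh" and "positive_definite Nsh"
    and "diagonal_matrix Ma" and "positive_definite Ma"
    and "diagonal_matrix Mb" and "positive_definite Mb"
    and "\<exists>qch xch qpr Vsh xa xb.
           equilibrium Sys (qch, xch, qpr, Vsh, xa, xb) \<and> (\<forall>i. qpr $ i \<noteq> 0)"
  shows "\<exists>e. asymptotically_stable Sys e \<and>
           (\<exists>\<delta>>0. \<forall>qch xch qpr Vsh xa xb.
              trajectory Sys (\<lambda>t. (qch t, xch t, qpr t, Vsh t, xa t, xb t)) \<and>
              dist (qch 0, xch 0, qpr 0, Vsh 0, xa 0, xb 0) e < \<delta> \<longrightarrow>
              (qch \<longlongrightarrow> qref) at_top \<and> (Vsh \<longlongrightarrow> Vref) at_top)"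
proof -
  note pd = \<open>positive_definite Jch\<close> \<open>positive_definite Jpr\<close> \<open>positive_definite Mch\<close>
    \<open>positive_definite Nch\<close> \<open>positive_definite Npr\<close> \<open>positive_definite Nsh\<close>
    \<open>positive_definite Ma\<close> \<open>positive_definite Mb\<close>
  have sym: "symmetric_matrix Jpr" "symmetric_matrix Mch" "symmetric_matrix Ma" "symmetric_matrix Mb"
    using assms by (auto intro: diagonal_imp_symmetric_matrix)
  obtain Jchi where Jchi: "\<And>x. Jchi *v (Jch *v x) = x" "\<And>x. Jch *v (Jchi *v x) = x"
    using positive_definite_inverse[OF pd(1)] by metis
  obtain Jpri where Jpri: "\<And>x. Jpri *v (Jpr *v x) = x" "\<And>x. Jpr *v (Jpri *v x) = x"
    using positive_definite_inverse[OF pd(2)] by metis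
  obtain Mchi where Mchi: "\<And>x. Mchi *v (Mch *v x) = x" "symmetric_matrix Mchi" "positive_definite Mchi"
    using positive_definite_inverse[OF pd(3)] sym(2) by metis
  obtain Mai where Mai: "\<And>x. Mai *v (Ma *v x) = x" "symmetric_matrix Mai" "positive_definite Mai"
    using positive_definite_inverse[OF pd(7)] sym(3) by metis
  obtain Mbi where Mbi: "\<And>x. Mbi *v (Mb *v x) = x" "symmetric_matrix Mbi" "positive_definite Mbi"
    using positive_definite_inverse[OF pd(8)] sym(4) by metis
  define F where "F = closed_loop_field Jchi Jpri Jpr fch \<theta> B Mch Nch Npr Nsh Ma Mb qref Vref"
  have S: "Sys x v \<longleftrightarrow> v = F x" for x v
    unfolding Sys_def F_def by (rule closed_loop_iff_field[OF Jchi Jpri])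
  define q0 where "q0 = B *v qref"
  define e where "e = (qref, - fch qref, q0, Vref, q0, \<theta>)"
  from assms(22) obtain qch xch qpr Vsh xa xb
    where eq: "equilibrium Sys (qch, xch, qpr, Vsh, xa, xb)" and nz: "\<forall>i. qpr $ i \<noteq> 0" by blast
  \<comment> \<open>The assumed equilibrium must be \<open>e\<close>; this gives
    \<open>F e = 0\<close> and transfers the nonzero entries to \<open>q0\<close>.\<close>
  note eq' = closed_loop_equilibrium[OF eq[unfolded Sys_def] pd(3) pd(7) pd(8) nz]
  have Fe: "F e = 0" and q0: "\<forall>i. q0 $ i \<noteq> 0"
    using eq nz unfolding equilibrium_def S eq' by (auto simp: e_def q0_def)
  \<comment> \<open>The radius \<open>r0\<close> fixes the neighbourhood for all local estimates:
    positivity of the \<open>W\<close> product, the Lipschitz constants \<open>LF\<close> and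
    \<open>L\<close>, and the bound \<Omega> on \<open>W\<close>.\<close>
  obtain r0 \<omega> where r0: "0 < r0" and \<omega>: "0 < \<omega>"
    "\<And>q b. norm q \<le> r0 \<Longrightarrow> \<omega> * (norm b)\<^sup>2 \<le> (W (q0 + q) *v b) \<bullet> (W q0 *v b)"
    using W_product_coercive[OF q0] by blast
  obtain LF where LF: "LF-lipschitz_on (cball e r0) F"
    using lipschitzian_on_closed_loop_field[OF assms(6), of "cball e r0"]
    unfolding lipschitzian_on_def F_def by (metis bounded_cball)
  obtain L where L: "L-lipschitz_on (cball qref r0) fch"
    using continuously_differentiable_lipschitzian_on[OF assms(6), of "cball qref r0"]
    by (auto simp: lipschitzian_on_def)
  have L0: "0 \<le> L" by (rule lipschitz_on_nonneg[OF L])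
  define \<Omega> where "\<Omega> = (norm q0 + r0)\<^sup>2"
  have \<Omega>0: "0 \<le> \<Omega>" by (simp add: \<Omega>_def)
  obtain c k where c: "0 < c" and k: "0 < k" and energy:
    "\<And>p s z v a b p' s' z' v' a' b' \<phi> D.
      Jch *v p' = \<phi> - Nch *v p + s \<Longrightarrow> s' = - (Mch *v p) \<Longrightarrow>
      Jpr *v z' = D *v b - v - Npr *v z \<Longrightarrow> v' = z + a - Nsh *v v - B *v p \<Longrightarrow>
      a' = - (Ma *v v) \<Longrightarrow> b' = - (Mb *v (D *v z)) \<Longrightarrow> symmetric_matrix D \<Longrightarrow> p \<bullet> \<phi> \<le> 0 \<Longrightarrow>
      c * (p \<bullet> (Jch *v p') + s \<bullet> (Mchi *v s')) +
        (z \<bullet> (Jpr *v z') + v \<bullet> v' + a \<bullet> (Mai *v a') + b \<bullet> (Mbi *v b'))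
      \<le> - k * ((norm p)\<^sup>2 + (norm z)\<^sup>2 + (norm v)\<^sup>2)"
    by (rule energy_dissipation[where Jch = Jch and Mch = Mch and Nch = Nch and Jpr = Jpr and Npr = Npr
          and Nsh = Nsh and Ma = Ma and Mb = Mb and B = B, OF Mchi(1) Mai(1) Mbi(1) pd(4-6)]) blast
  obtain C1 m where C1: "0 \<le> C1" and m: "0 < m" and cross:
    "\<And>p s z v a b p' s' z' v' a' b' \<phi> D u w.
      Jch *v p' = \<phi> - Nch *v p + s \<Longrightarrow> s' = - (Mch *v p) \<Longrightarrow>
      Jpr *v z' = D *v b - v - Npr *v z \<Longrightarrow> v' = z + a - Nsh *v v - B *v p \<Longrightarrow>
      a' = - (Ma *v v) \<Longrightarrow> b' = - (Mb *v (D *v z)) \<Longrightarrow>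
      norm \<phi> \<le> L * norm p \<Longrightarrow> norm (D *v z) \<le> \<Omega> * norm z \<Longrightarrow>
      \<omega> * (norm b)\<^sup>2 \<le> (D *v b) \<bullet> (W q0 *v b) \<Longrightarrow>
      u = sqrt ((norm p)\<^sup>2 + (norm z)\<^sup>2 + (norm v)\<^sup>2) \<Longrightarrow>
      w = sqrt ((norm s)\<^sup>2 + (norm a)\<^sup>2 + (norm b)\<^sup>2) \<Longrightarrow>
      m * w\<^sup>2 - C1 * (u * w) - C1 * u\<^sup>2 \<le>
        (s \<bullet> (Jch *v p') + s' \<bullet> (Jch *v p)) + (a \<bullet> v' + a' \<bullet> v)
        + (z \<bullet> (Jpr *v (W q0 *v b')) + z' \<bullet> (Jpr *v (W q0 *v b)))"
    by (rule cross_term_derivative[where Jch = Jch and Mch = Mch and Nch = Nch and Npr = Npr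
          and Nsh = Nsh and Ma = Ma and Mb = Mb and B = B and ?D0.0 = "W q0", OF sym(1) \<omega>(1) \<Omega>0 L0]) blast
  obtain \<mu> C2 where \<mu>: "0 < \<mu>" and C2: "0 \<le> C2" and coercive:
    "\<And>\<epsilon> p s q v a b z. 0 \<le> \<epsilon> \<Longrightarrow> \<epsilon> * C2 \<le> \<mu> \<Longrightarrow> z = q - a + Nsh *v v \<Longrightarrow>
      \<mu> * ((norm p)\<^sup>2 + (norm s)\<^sup>2 + (norm z)\<^sup>2 + (norm v)\<^sup>2 + (norm a)\<^sup>2 + (norm b)\<^sup>2) \<le>
      lyapunov_form c \<epsilon> Jch Mchi Jpr Nsh Mai Mbi (W q0) (p, s, q, v, a, b) (p, s, q, v, a, b)"
    by (rule lyapunov_form_coercive[where Nsh = Nsh and ?D0.0 = "W q0",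
          OF pd(1) Mchi(3) pd(2) Mai(3) Mbi(3) c]) blast
  \<comment> \<open>A single \<epsilon> must serve both absorption and coercivity. The sum works for
    both, since enlarging \<open>C1\<close> only weakens the lower bound on the cross terms.\<close>
  have C12: "0 \<le> C1 + C2" using C1 C2 by simp
  obtain \<epsilon> \<kappa> where \<epsilon>_pos: "0 < \<epsilon>" and \<kappa>_pos: "0 < \<kappa>" and \<epsilon>_le: "\<epsilon> * (C1 + C2) \<le> \<mu>" and absorb:
    "\<And>u w. - k * u\<^sup>2 - \<epsilon> * (m * w\<^sup>2 - (C1 + C2) * (u * w) - (C1 + C2) * u\<^sup>2) \<le> - \<kappa> * (u\<^sup>2 + w\<^sup>2)"
    by (rule cross_term_absorption[OF k m C12 \<mu>]) blast
  note \<epsilon> = \<epsilon>_pos \<epsilon>_le and \<kappa> = \<kappa>_pos absorb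
  have "\<epsilon> * C2 \<le> \<epsilon> * (C1 + C2)" using \<epsilon>(1) C1 by simp
  with \<epsilon> have \<epsilon>C2: "\<epsilon> * C2 \<le> \<mu>" by linarith
  obtain K where K: "0 < K"
    "\<And>(p :: real ^ 'ch) (s :: real ^ 'ch) q v a (b :: real ^ 'pr) z. z = q - a + Nsh *v v \<Longrightarrow>
      (norm (p, s, q, v, a, b))\<^sup>2 \<le>
      K * ((norm p)\<^sup>2 + (norm s)\<^sup>2 + (norm z)\<^sup>2 + (norm v)\<^sup>2 + (norm a)\<^sup>2 + (norm b)\<^sup>2)"
    by (rule norm_dh_state_le[of Nsh]) blast
  define \<beta> where "\<beta> = lyapunov_form c \<epsilon> Jch Mchi Jpr Nsh Mai Mbi (W q0)"
  have \<beta>_lower: "\<mu> / K * (norm y)\<^sup>2 \<le> \<beta> y y" for y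
  proof -
    obtain p s q v a b where y: "y = (p, s, q, v, a, b)" by (metis prod.exhaust)
    have "\<mu> / K * (norm y)\<^sup>2 \<le> \<mu> / K * (K * ((norm p)\<^sup>2 + (norm s)\<^sup>2 + (norm (q - a + Nsh *v v))\<^sup>2
        + (norm v)\<^sup>2 + (norm a)\<^sup>2 + (norm b)\<^sup>2))"
      unfolding y using \<mu> K(1) by (intro mult_left_mono K(2)) auto
    also have "\<dots> = \<mu> * ((norm p)\<^sup>2 + (norm s)\<^sup>2 + (norm (q - a + Nsh *v v))\<^sup>2
        + (norm v)\<^sup>2 + (norm a)\<^sup>2 + (norm b)\<^sup>2)" using K(1) by simp
    also have "\<dots> \<le> \<beta> y y"
      unfolding y \<beta>_def using \<epsilon> by (intro coercive \<epsilon>C2) auto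
    finally show ?thesis .
  qed
  have \<beta>_decrease: "\<beta> y (F (e + y)) + \<beta> (F (e + y)) y \<le> - (\<kappa> / K) * (norm y)\<^sup>2"
    if y_le: "norm y \<le> r0" for y
  proof -
    obtain p s q v a b where y: "y = (p, s, q, v, a, b)" by (metis prod.exhaust)
    obtain p' s' q' v' a' b' where v: "F (e + y) = (p', s', q', v', a', b')" by (metis prod.exhaust)
    have p: "norm p \<le> r0" and q: "norm q \<le> r0"
      using y_le unfolding y
      by (meson norm_fst_le norm_snd_le order_trans)+
    define z where "z = q - a + Nsh *v v"
    define z' where "z' = q' - a' + Nsh *v v'"
    define \<phi> where "\<phi> = fch (qref + p) - fch qref"
    define D where "D = W (q0 + q)"
    define u where "u = sqrt ((norm p)\<^sup>2 + (norm z)\<^sup>2 + (norm v)\<^sup>2)"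
    define w where "w = sqrt ((norm s)\<^sup>2 + (norm a)\<^sup>2 + (norm b)\<^sup>2)"
    have "Sys (e + y) (p', s', q', v', a', b')" by (simp add: S v)
    then have "closed_loop Jch Jpr fch \<theta> B Mch Nch Npr Nsh Ma Mb qref Vref
      (qref + p, - fch qref + s, B *v qref + q, Vref + v, B *v qref + a, \<theta> + b) (p', s', q', v', a', b')"
      by (simp add: Sys_def e_def y q0_def del: closed_loop.simps)
    note dev = closed_loop_deviation[OF this z_def z'_def, folded q0_def, folded D_def \<phi>_def]
    have \<phi>p: "p \<bullet> \<phi> \<le> 0"
      using assms(7)[unfolded monotone_operator_def, rule_format, of "qref + p" qref]
      by (simp add: \<phi>_def inner_diff_right)
    have \<phi>L: "norm \<phi> \<le> L * norm p"
      using lipschitz_on_normD[OF L, of "qref + p" qref] p r0 by (simp add: \<phi>_def dist_norm)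
    have "norm (q0 + q) \<le> norm q0 + r0" using norm_triangle_ineq[of q0 q] q by linarith
    then have "(norm (q0 + q))\<^sup>2 \<le> \<Omega>" unfolding \<Omega>_def by (intro power_mono) auto
    then have Dz: "norm (D *v z) \<le> \<Omega> * norm z"
      unfolding D_def using norm_W_mult_le mult_right_mono norm_ge_zero order_trans by metis
    have D_sym: "symmetric_matrix D" by (simp add: D_def symmetric_matrix_W)
    have u2: "u\<^sup>2 = (norm p)\<^sup>2 + (norm z)\<^sup>2 + (norm v)\<^sup>2" and w2: "w\<^sup>2 = (norm s)\<^sup>2 + (norm a)\<^sup>2 + (norm b)\<^sup>2"
      and uw: "0 \<le> u" "0 \<le> w" by (auto simp: u_def w_def)
    define X where "X = (s \<bullet> (Jch *v p') + s' \<bullet> (Jch *v p)) + (a \<bullet> v' + a' \<bullet> v)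
        + (z \<bullet> (Jpr *v (W q0 *v b')) + z' \<bullet> (Jpr *v (W q0 *v b)))"
    have "m * w\<^sup>2 - C1 * (u * w) - C1 * u\<^sup>2 \<le> X"
      unfolding X_def by (rule cross[OF dev \<phi>L Dz \<omega>(2)[OF q, folded D_def] u_def w_def])
    moreover have "0 \<le> C2 * (u * w)" "0 \<le> C2 * u\<^sup>2" using C2 uw by simp_all
    ultimately have "m * w\<^sup>2 - (C1 + C2) * (u * w) - (C1 + C2) * u\<^sup>2 \<le> X" by (simp add: distrib_right)
    then have \<epsilon>X: "\<epsilon> * (m * w\<^sup>2 - (C1 + C2) * (u * w) - (C1 + C2) * u\<^sup>2) \<le> \<epsilon> * X"
      using \<epsilon>(1) by (intro mult_left_mono) auto
    have "\<beta> y (F (e + y)) + \<beta> (F (e + y)) y =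
        c * (p \<bullet> (Jch *v p') + s \<bullet> (Mchi *v s')) +
        (z \<bullet> (Jpr *v z') + v \<bullet> v' + a \<bullet> (Mai *v a') + b \<bullet> (Mbi *v b')) - \<epsilon> * X"
      unfolding v unfolding y \<beta>_def X_def
      by (rule lyapunov_form_symmetrized[OF assms(2) Mchi(2) sym(1) Mai(2) Mbi(2) z_def z'_def])
    also have "\<dots> \<le> - k * u\<^sup>2 - \<epsilon> * (m * w\<^sup>2 - (C1 + C2) * (u * w) - (C1 + C2) * u\<^sup>2)"
      unfolding u2[symmetric] using energy[OF dev D_sym \<phi>p, folded u2] \<epsilon>X by (rule diff_mono)
    also have "\<dots> \<le> - \<kappa> * (u\<^sup>2 + w\<^sup>2)" by (rule \<kappa>(2))
    also have "\<dots> \<le> - (\<kappa> / K) * (norm y)\<^sup>2"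
    proof -
      have "(norm y)\<^sup>2 \<le> K * (u\<^sup>2 + w\<^sup>2)"
        using K(2)[OF z_def, of p s b] unfolding y u2 w2 by (simp add: add_ac)
      then have "\<kappa> / K * (norm y)\<^sup>2 \<le> \<kappa> / K * (K * (u\<^sup>2 + w\<^sup>2))"
        using \<kappa>(1) K(1) by (intro mult_left_mono) auto
      then show ?thesis using K(1) by simp
    qed
    finally show ?thesis .
  qed
  have stable: "asymptotically_stable Sys e"
    by (rule quadratic_lyapunov_asymptotically_stable[OF S Fe LF r0 _ _ \<beta>_lower _ \<beta>_decrease])
      (use \<mu> K \<kappa> in \<open>auto simp: \<beta>_def bounded_bilinear_lyapunov_form\<close>)
  then obtain \<delta> where \<delta>: "0 < \<delta>"
    "\<And>x. trajectory Sys x \<Longrightarrow> dist (x 0) e < \<delta> \<Longrightarrow> (x \<longlongrightarrow> e) at_top"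
    unfolding asymptotically_stable_def locally_attractive_def by blast
  show ?thesis
  proof (intro exI[of _ e] exI[of _ \<delta>] conjI stable \<delta>(1) allI impI; elim conjE)
    fix qch xch qpr Vsh xa xb
    assume "trajectory Sys (\<lambda>t. (qch t, xch t, qpr t, Vsh t, xa t, xb t))"
      "dist (qch 0, xch 0, qpr 0, Vsh 0, xa 0, xb 0) e < \<delta>"
    from \<delta>(2)[OF this]
    have lim: "((\<lambda>t. (qch t, xch t, qpr t, Vsh t, xa t, xb t)) \<longlongrightarrow> e) at_top" .
    show "(qch \<longlongrightarrow> qref) at_top"
      using tendsto_fst[OF lim] by (simp add: e_def)
    show "(Vsh \<longlongrightarrow> Vref) at_top"
      using tendsto_fst[OF tendsto_snd[OF tendsto_snd[OF tendsto_snd[OF lim]]]] by (simp add: e_def)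
  qed
qed

end
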